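(* There is a polynomial time algorithm that, given a finite data set $P\subset\mathbb{R}$ and $\varepsilon\in(0,1)$, outputs an $\varepsilon$-coreset of $P$ for (one-dimensional) $1$-Median of size $\tilde{O}(\varepsilon^{-1/2})$.
   Context: For a finite $P\subset\mathbb{R}$ and a center $c\in\mathbb{R}$, the $1$-Median cost is $\mathrm{cost}(P,c)=\sum_{p\in P}|p-c|$. An $\varepsilon$-coreset of $P$ for $1$-Median is a subset $S\subseteq P$ with a weight function $w:S\to\mathbb{R}_{\ge 0}$ such that for every $c\in\mathbb{R}$, $$(1-\varepsilon)\,\mathrm{cost}(P,c)\le\sum_{p\in S}w(p)\,|p-c|\le(1+\varepsilon)\,\mathrm{cost}(P,c).$$ Its size is $|S|$. The notation $\tilde{O}(\varepsilon^{-1/2})$ means a bound of the form $C\,\varepsilon^{-1/2}(1+\log(1/\varepsilon))^{C}$ for a universal constant $C>0$, independent of $P$, $|P|$ and $\varepsilon$. *)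

theory Defs
  imports Complex_Main "HOL-Computational_Algebra.Polynomial"
begin

definition cost :: "real set \<Rightarrow> real \<Rightarrow> real" where
  "cost P c = (\<Sum>p\<in>P. \<bar>p - c\<bar>)"

definition is_coreset :: "real \<Rightarrow> real set \<Rightarrow> real set \<Rightarrow> (real \<Rightarrow> real) \<Rightarrow> bool" where
  "is_coreset \<epsilon> P S w \<longleftrightarrow>
     S \<subseteq> P \<and> (\<forall>p\<in>S. 0 \<le> w p) \<and>
     (\<forall>c. (1 - \<epsilon>) * cost P c \<le> (\<Sum>p\<in>S. w p * \<bar>p - c\<bar>) \<and>
          (\<Sum>p\<in>S. w p * \<bar>p - c\<bar>) \<le> (1 + \<epsilon>) * cost P c)"

text \<open>
  Data points are arbitrary real numbers, so algorithms are programs of a real RAM, presented as a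
  structured language. Its memory consists of finitely many (for a fixed program) index registers
  and arrays of real cells. Cells support the field operations and comparison at unit cost; there
  is no rounding and no conversion between reals and indices, and the only constants a program may
  contain are natural numbers. Indices support only addition and truncated subtraction (no
  multiplication), so that unit cost is a polynomially adequate measure for them.
  As usual in HOL, division by zero yields zero.
\<close>

type_synonym vname = string

datatype iexp =
    IConst nat
  | Reg vname
  | IPlus iexp iexp
  | IMinus iexp iexp

datatype rexp =
    RConst nat
  | Cell vname iexp
  | RPlus rexp rexp
  | RMinus rexp rexp
  | RTimes rexp rexp
  | RDiv rexp rexp

datatype bexp =
    ILess iexp iexp
  | RLess rexp rexp
  | BNot bexp
  | BAnd bexp bexp

datatype com =
    Skip
  | SetReg vname iexp
  | SetCell vname iexp rexp
  | Seq com com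
  | Cond bexp com com
  | While bexp com

record state =
  regs :: "vname \<Rightarrow> nat"
  cells :: "vname \<Rightarrow> nat \<Rightarrow> real"

fun ival :: "iexp \<Rightarrow> state \<Rightarrow> nat" where
  "ival (IConst n) s = n"
| "ival (Reg x) s = regs s x"
| "ival (IPlus a b) s = ival a s + ival b s"
| "ival (IMinus a b) s = ival a s - ival b s"

fun rval :: "rexp \<Rightarrow> state \<Rightarrow> real" where
  "rval (RConst n) s = real n"
| "rval (Cell a i) s = cells s a (ival i s)"
| "rval (RPlus a b) s = rval a s + rval b s"
| "rval (RMinus a b) s = rval a s - rval b s"
| "rval (RTimes a b) s = rval a s * rval b s"
| "rval (RDiv a b) s = rval a s / rval b s"

fun bval :: "bexp \<Rightarrow> state \<Rightarrow> bool" where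
  "bval (ILess a b) s \<longleftrightarrow> ival a s < ival b s"
| "bval (RLess a b) s \<longleftrightarrow> rval a s < rval b s"
| "bval (BNot b) s \<longleftrightarrow> \<not> bval b s"
| "bval (BAnd b c) s \<longleftrightarrow> bval b s \<and> bval c s"

definition set_reg :: "vname \<Rightarrow> nat \<Rightarrow> state \<Rightarrow> state" where
  "set_reg x n s = s\<lparr>regs := (regs s)(x := n)\<rparr>"

definition set_cell :: "vname \<Rightarrow> nat \<Rightarrow> real \<Rightarrow> state \<Rightarrow> state" where
  "set_cell a i r s = s\<lparr>cells := (cells s)(a := (cells s a)(i := r))\<rparr>"

text \<open>
  \<open>exec c s k t\<close>: started in \<open>s\<close>, the program \<open>c\<close> halts in \<open>t\<close> after \<open>k\<close> steps. Every assignment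
  and every test counts as one step; since the expressions in a fixed program have bounded size,
  \<open>k\<close> is the number of elementary operations up to a constant factor depending on the program.
\<close>

inductive exec :: "com \<Rightarrow> state \<Rightarrow> nat \<Rightarrow> state \<Rightarrow> bool" where
  Skip: "exec Skip s 1 s"
| SetReg: "exec (SetReg x a) s 1 (set_reg x (ival a s) s)"
| SetCell: "exec (SetCell x i a) s 1 (set_cell x (ival i s) (rval a s) s)"
| Seq: "exec c s k s' \<Longrightarrow> exec d s' l t \<Longrightarrow> exec (Seq c d) s (k + l) t"
| CondTrue: "bval b s \<Longrightarrow> exec c s k t \<Longrightarrow> exec (Cond b c d) s (Suc k) t"
| CondFalse: "\<not> bval b s \<Longrightarrow> exec d s k t \<Longrightarrow> exec (Cond b c d) s (Suc k) t"
| WhileFalse: "\<not> bval b s \<Longrightarrow> exec (While b c) s 1 s"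
| WhileTrue: "bval b s \<Longrightarrow> exec c s k s' \<Longrightarrow> exec (While b c) s' l t \<Longrightarrow>
    exec (While b c) s (Suc (k + l)) t"

lemma exec_deterministic:
  "exec c s k t \<Longrightarrow> exec c s k' t' \<Longrightarrow> k' = k \<and> t' = t"
proof (induction arbitrary: k' t' rule: exec.induct)
  case (Seq c s k s' d l t)
  from Seq.prems show ?case by cases (use Seq.IH in blast)
next
  case (WhileTrue b s c k s' l t)
  from WhileTrue.prems show ?case by cases (use WhileTrue in blast)+
qed (blast elim: exec.cases)+

text \<open>The data points are given in array \<open>P\<close> (in the order of the list), their number in register
  \<open>n\<close>, and \<open>\<epsilon>\<close> in the first cell of \<open>eps\<close>; everything else is zero.\<close>

definition input_state :: "real list \<Rightarrow> real \<Rightarrow> state" where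
  "input_state xs \<epsilon> =
     \<lparr>regs = (\<lambda>x. if x = ''n'' then length xs else 0),
      cells = (\<lambda>a i. if a = ''P'' \<and> i < length xs then xs ! i
                     else if a = ''eps'' \<and> i = 0 then \<epsilon> else 0)\<rparr>"

text \<open>A final state presents a weighted set by listing its points, without repetition, in the first
  \<open>m\<close> cells of \<open>S\<close>, and their weights in the corresponding cells of \<open>W\<close>.\<close>

definition outputs :: "state \<Rightarrow> real set \<Rightarrow> (real \<Rightarrow> real) \<Rightarrow> bool" where
  "outputs t S w \<longleftrightarrow>
     inj_on (cells t ''S'') {..<regs t ''m''} \<and>
     S = cells t ''S'' ` {..<regs t ''m''} \<and>
     (\<forall>i<regs t ''m''. w (cells t ''S'' i) = cells t ''W'' i)"

end

theory Submission
  imports Defs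
begin

text \<open>
  The function \<open>f c = cost P c\<close> is convex and piecewise linear with kinks in \<open>P\<close>. Interpolate it linearly
  between the points of a subset \<open>S\<close> of \<open>P\<close> that contains both extremes, and continue it with the slopes
  \<open>\<plusminus>\<bar>P\<bar>\<close> outside. The interpolant lies above \<open>f\<close> and equals \<open>\<Sum>p\<in>S. w p * \<bar>p - c\<bar>\<close>, where \<open>w p \<ge> 0\<close> is
  half the jump of its slope at \<open>p\<close>. So it suffices to choose few points \<open>S\<close> with chords below
  \<open>(1 + \<epsilon>) f\<close>, and the algorithm does this greedily: from each chosen point it moves to the last
  point that the chord condition allows.

  To count the points, let \<open>z\<close> minimise \<open>f\<close> on \<open>P\<close>, \<open>R = f z / \<bar>P\<bar>\<close>, \<open>D x = R + \<bar>x - z\<bar>\<close> and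
  \<open>\<phi> x = (x - z) / D x\<close>. Then \<open>f x \<ge> \<bar>P\<bar> D x / 3\<close> on \<open>P\<close>, and the condition can fail on an interval \<open>[u, v]\<close>
  on one side of \<open>z\<close> only if \<open>\<epsilon>\<close> is at most a constant times the product of \<open>\<phi> v - \<phi> u\<close> and
  \<open>(\<Sum>p\<in>P \<inter> [u, v]. D p) / (\<bar>P\<bar> R)\<close>. Over disjoint intervals each factor sums to at most 2, so by
  AM-GM there are \<open>O(1 / sqrt \<epsilon>)\<close> such intervals; no logarithm is lost.
\<close>

subsection \<open>Chords of the absolute value\<close>

definition chord :: "(real \<Rightarrow> real) \<Rightarrow> real \<Rightarrow> real \<Rightarrow> real \<Rightarrow> real" where
  "chord h u v y = h u + (h v - h u) / (v - u) * (y - u)"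

lemma chord_ends: "u < v \<Longrightarrow> chord h u v u = h u" "u < v \<Longrightarrow> chord h u v v = h v"
  by (auto simp: chord_def)

lemma chord_alt:
  assumes "u < v"
  shows "chord h u v y = ((v - y) * h u + (y - u) * h v) / (v - u)"
  using assms by (simp add: chord_def field_simps)

lemma chord_sum: "chord (\<lambda>x. \<Sum>i\<in>A. h i x) u v y = (\<Sum>i\<in>A. chord (h i) u v y)"
  by (simp add: chord_def sum.distrib sum_divide_distrib[symmetric] sum_distrib_right[symmetric]
      sum_subtractf)

text \<open>Convexity: \<open>p - y\<close> is the convex combination of \<open>p - u\<close> and
  \<open>p - v\<close> with weights proportional to \<open>v - y\<close> and \<open>y - u\<close>,
  so the triangle inequality applies.\<close>

lemma chord_abs_ge:
  assumes "u \<le> y" "y \<le> v" "u < v"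
  shows "\<bar>p - y\<bar> \<le> chord (\<lambda>x. \<bar>p - x\<bar>) u v y"
proof -
  have "\<bar>(v - y) * (p - u) + (y - u) * (p - v)\<bar> \<le> (v - y) * \<bar>p - u\<bar> + (y - u) * \<bar>p - v\<bar>"
    using assms by (intro order.trans[OF abs_triangle_ineq]) (simp add: abs_mult)
  moreover have "(v - y) * (p - u) + (y - u) * (p - v) = (v - u) * (p - y)"
    by (simp add: algebra_simps)
  ultimately show ?thesis
    using assms by (simp add: chord_alt pos_le_divide_eq abs_mult mult.commute)
qed

text \<open>The distance to \<open>p\<close> is affine on \<open>[u, v]\<close> unless its kink lies
  strictly inside, so only data inside the interval make a chord of the cost exceed the
  cost.\<close>

lemma chord_abs_outside:
  assumes "u \<le> y" "y \<le> v" "u < v" "p \<le> u \<or> v \<le> p"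
  shows "chord (\<lambda>x. \<bar>p - x\<bar>) u v y = \<bar>p - y\<bar>"
proof -
  have "p \<le> u \<Longrightarrow> \<bar>p - u\<bar> = u - p \<and> \<bar>p - v\<bar> = v - p \<and> \<bar>p - y\<bar> = y - p"
    and "v \<le> p \<Longrightarrow> \<bar>p - u\<bar> = p - u \<and> \<bar>p - v\<bar> = p - v \<and> \<bar>p - y\<bar> = p - y"
    using assms by auto
  with assms(4) have "(v - y) * \<bar>p - u\<bar> + (y - u) * \<bar>p - v\<bar> = \<bar>p - y\<bar> * (v - u)"
    by (auto simp: algebra_simps)
  with assms show ?thesis by (simp add: chord_alt)
qed

text \<open>The excess is twice the Green function of the negated second derivative on
  \<open>[u, v]\<close> with zero boundary values; in particular it is symmetric in \<open>p\<close>
  and \<open>y\<close>.\<close>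

lemma chord_abs_inside:
  assumes "u \<le> y" "y \<le> v" "u < v" "u \<le> p" "p \<le> v"
  shows "chord (\<lambda>x. \<bar>p - x\<bar>) u v y - \<bar>p - y\<bar> = 2 * (min p y - u) * (v - max p y) / (v - u)"
proof -
  have "(v - y) * \<bar>p - u\<bar> + (y - u) * \<bar>p - v\<bar> - \<bar>p - y\<bar> * (v - u) = 2 * (min p y - u) * (v - max p y)"
    using assms by (auto simp: abs_if min_def max_def algebra_simps)
  with assms show ?thesis by (simp add: chord_alt field_simps)
qed

section \<open>Weighted bounds for the excess of a chord\<close>

lemma hyperbolic_bound_right:
  fixes R u v s t :: real
  assumes "0 < R" "0 \<le> u" "u \<le> s" "s \<le> t" "t \<le> v" "u < v"
  shows "(s - u) * (v - t) * ((R + u) * (R + v)) \<le> 2 * ((R + s) * (R + t)) * (v - u)\<^sup>2"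
proof -
  \<comment> \<open>If \<open>v - u\<close> is at least half of \<open>R + v\<close>, then
    \<open>s - u \<le> R + t\<close> suffices. Otherwise \<open>R + v < 2 * (R + u)\<close>, so
    \<open>R + x\<close> at most doubles across the interval. Either case costs the factor
    2.\<close>
  have key: "(s - u) * (R + v) \<le> 2 * (R + t) * (v - u)"
  proof (cases "R + v \<le> 2 * (v - u)")
    case True
    have "(s - u) * (R + v) \<le> (R + t) * (2 * (v - u))"
      using True assms by (intro mult_mono) auto
    then show ?thesis by (simp only: mult_ac)
  next
    case False
    have "(s - u) * (R + v) \<le> (v - u) * (2 * (R + t))"
      using False assms by (intro mult_mono) auto
    then show ?thesis by (simp only: mult_ac)
  qed
  have "(v - t) * (R + u) * ((s - u) * (R + v)) \<le> (v - u) * (R + s) * (2 * (R + t) * (v - u))"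
  proof (rule mult_mono)
    show "(v - t) * (R + u) \<le> (v - u) * (R + s)"
      using assms by (intro mult_mono) auto
  qed (use assms key in auto)
  then show ?thesis by (simp add: power2_eq_square mult_ac)
qed

text \<open>The bound separates the variables: \<open>y\<close> and \<open>p\<close> enter only
  through their weights, and the ends only through a quotient that
  \<open>hyperbolic_increment\<close> turns into an increment. It is
  \<open>hyperbolic_bound_right\<close> in distances from \<open>z\<close>, with \<open>s\<close>
  and \<open>t\<close> the smaller and larger of \<open>p\<close> and \<open>y\<close>.\<close>

lemma chord_abs_gap_right:
  fixes R z u v y p :: real
  assumes "0 < R" "z \<le> u" "u \<le> y" "y \<le> v" "u < v" "u \<le> p" "p \<le> v"
  shows "chord (\<lambda>x. \<bar>p - x\<bar>) u v y - \<bar>p - y\<bar>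
    \<le> 4 * (R + \<bar>y - z\<bar>) * (R + \<bar>p - z\<bar>) * ((v - u) / ((R + \<bar>u - z\<bar>) * (R + \<bar>v - z\<bar>)))"
proof -
  have "(min p y - u) * (v - max p y) * ((R + (u - z)) * (R + (v - z)))
      \<le> 2 * ((R + (min p y - z)) * (R + (max p y - z))) * (v - u)\<^sup>2"
    using hyperbolic_bound_right[of R "u - z" "min p y - z" "max p y - z" "v - z"] assms by simp
  also have "(R + (min p y - z)) * (R + (max p y - z)) = (R + (y - z)) * (R + (p - z))"
    by (auto simp: min_def max_def)
  finally have le: "(min p y - u) * (v - max p y) * ((R + (u - z)) * (R + (v - z)))
      \<le> 2 * ((R + (y - z)) * (R + (p - z))) * (v - u)\<^sup>2" .
  define a b l d e where "a = min p y - u" and "b = v - max p y" and "l = v - u"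
    and "d = (R + (u - z)) * (R + (v - z))" and "e = (R + (y - z)) * (R + (p - z))"
  have "0 < d" "0 < l" using assms by (simp_all add: d_def l_def)
  then have "2 * a * b / l \<le> 4 * e * (l / d)"
    using le unfolding a_def[symmetric] b_def[symmetric] d_def[symmetric] e_def[symmetric] l_def[symmetric]
    by (simp add: divide_simps power2_eq_square mult_ac)
  then have "2 * (min p y - u) * (v - max p y) / (v - u)
      \<le> 4 * ((R + (y - z)) * (R + (p - z))) * ((v - u) / ((R + (u - z)) * (R + (v - z))))"
    unfolding a_def b_def d_def e_def l_def .
  moreover have "\<bar>y - z\<bar> = y - z" "\<bar>p - z\<bar> = p - z" "\<bar>u - z\<bar> = u - z" "\<bar>v - z\<bar> = v - z"
    using assms by auto
  ultimately show ?thesis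
    using assms by (simp only: chord_abs_inside mult.assoc)
qed

text \<open>Reflection at 0 exchanges the ends and moves the interval to the right of
  \<open>- z\<close>, which reduces this to \<open>chord_abs_gap_right\<close>.\<close>

lemma chord_abs_gap_left:
  fixes R z u v y p :: real
  assumes "0 < R" "v \<le> z" "u \<le> y" "y \<le> v" "u < v" "u \<le> p" "p \<le> v"
  shows "chord (\<lambda>x. \<bar>p - x\<bar>) u v y - \<bar>p - y\<bar>
    \<le> 4 * (R + \<bar>y - z\<bar>) * (R + \<bar>p - z\<bar>) * ((v - u) / ((R + \<bar>u - z\<bar>) * (R + \<bar>v - z\<bar>)))"
proof -
  have refl: "chord (\<lambda>x. \<bar>- p - x\<bar>) (- v) (- u) (- y) = chord (\<lambda>x. \<bar>p - x\<bar>) u v y"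
    using assms by (simp add: chord_alt abs_if algebra_simps)
  have "chord (\<lambda>x. \<bar>- p - x\<bar>) (- v) (- u) (- y) - \<bar>- p - - y\<bar>
    \<le> 4 * (R + \<bar>- y - - z\<bar>) * (R + \<bar>- p - - z\<bar>)
        * ((- u - - v) / ((R + \<bar>- v - - z\<bar>) * (R + \<bar>- u - - z\<bar>)))"
    using assms by (intro chord_abs_gap_right) auto
  moreover have "\<bar>- a - - b\<bar> = \<bar>a - b\<bar>" for a b :: real by simp
  ultimately show ?thesis
    unfolding refl by (simp add: mult.commute)
qed

text \<open>The function \<open>(x - z) / (R + \<bar>x - z\<bar>)\<close> has derivative
  \<open>R / (R + \<bar>x - z\<bar>)^2\<close>. Equality holds when \<open>u\<close> and
  \<open>v\<close> lie on the same side of \<open>z\<close>; otherwise the numerator gains the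
  positive term \<open>2 * (v - z) * (z - u)\<close>. In particular the function is
  increasing.\<close>

lemma hyperbolic_increment:
  fixes R z u v :: real
  assumes "0 < R" "u < v"
  shows "R * ((v - u) / ((R + \<bar>u - z\<bar>) * (R + \<bar>v - z\<bar>)))
    \<le> (v - z) / (R + \<bar>v - z\<bar>) - (u - z) / (R + \<bar>u - z\<bar>)"
proof -
  have pos: "0 < R + \<bar>u - z\<bar>" "0 < R + \<bar>v - z\<bar>" using assms by auto
  have "(v - z) / (R + \<bar>v - z\<bar>) - (u - z) / (R + \<bar>u - z\<bar>)
      = (R * (v - u) + ((v - z) * \<bar>u - z\<bar> - (u - z) * \<bar>v - z\<bar>)) / ((R + \<bar>u - z\<bar>) * (R + \<bar>v - z\<bar>))"
    using pos by (simp add: diff_frac_eq) (simp add: algebra_simps)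
  moreover have "0 \<le> (v - z) * \<bar>u - z\<bar> - (u - z) * \<bar>v - z\<bar>"
    using assms mult_nonneg_nonneg[of "v - z" "z - u"] by (auto simp: abs_if algebra_simps)
  ultimately show ?thesis using pos by (simp add: divide_right_mono)
qed

subsection \<open>Interpolation along the greedy chain\<close>

text \<open>\<open>X\<close> is total because it is later instantiated with the contents of an
  array; only indices below \<open>n\<close> carry data.\<close>

locale sorted_points =
  fixes X :: "nat \<Rightarrow> real" and n :: nat and \<epsilon> :: real
  assumes X_less: "\<And>i j. i < j \<Longrightarrow> j < n \<Longrightarrow> X i < X j"
    and eps_pos: "0 < \<epsilon>"
begin

lemma X_le: "i \<le> j \<Longrightarrow> j < n \<Longrightarrow> X i \<le> X j"
  using X_less[of i j] by (cases "i = j") auto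

definition f :: "real \<Rightarrow> real" where
  "f c = (\<Sum>i<n. \<bar>X i - c\<bar>)"

lemma f_nonneg: "0 \<le> f c"
  by (simp add: f_def sum_nonneg)

lemma chord_f: "chord f u v y = (\<Sum>i<n. chord (\<lambda>x. \<bar>X i - x\<bar>) u v y)"
  unfolding f_def[abs_def] by (rule chord_sum)

lemma f_le_chord: "u \<le> y \<Longrightarrow> y \<le> v \<Longrightarrow> u < v \<Longrightarrow> f y \<le> chord f u v y"
  unfolding chord_f by (auto simp: f_def intro!: sum_mono chord_abs_ge)

lemma f_lipschitz: "\<bar>f v - f u\<bar> \<le> real n * \<bar>v - u\<bar>"
proof -
  have "\<bar>f v - f u\<bar> \<le> (\<Sum>i<n. \<bar>\<bar>X i - v\<bar> - \<bar>X i - u\<bar>\<bar>)"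
    unfolding f_def sum_subtractf[symmetric] by (rule sum_abs)
  also have "\<dots> \<le> (\<Sum>i<n. \<bar>v - u\<bar>)" by (rule sum_mono) linarith
  finally show ?thesis by simp
qed

lemma f_below:
  assumes "c \<le> X 0"
  shows "f c = f (X 0) + real n * (X 0 - c)"
proof -
  have "f c = (\<Sum>i<n. \<bar>X i - X 0\<bar> + (X 0 - c))"
    unfolding f_def
  proof (rule sum.cong)
    fix i assume "i \<in> {..<n}"
    then show "\<bar>X i - c\<bar> = \<bar>X i - X 0\<bar> + (X 0 - c)" using X_le[of 0 i] assms by simp
  qed simp
  then show ?thesis by (simp add: f_def sum.distrib)
qed

lemma f_above:
  assumes "X (n - 1) \<le> c"
  shows "f c = f (X (n - 1)) + real n * (c - X (n - 1))"
proof -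
  have "f c = (\<Sum>i<n. \<bar>X i - X (n - 1)\<bar> + (c - X (n - 1)))"
    unfolding f_def
  proof (rule sum.cong)
    fix i assume "i \<in> {..<n}"
    then have "X i \<le> X (n - 1)" by (intro X_le) auto
    then show "\<bar>X i - c\<bar> = \<bar>X i - X (n - 1)\<bar> + (c - X (n - 1))" using assms by simp
  qed simp
  then show ?thesis by (simp add: f_def sum.distrib)
qed

text \<open>Every data point lies between the extremes, so its two distances add up to the full
  width. This makes the two outer rays of the interpolant cancel in
  \<open>weighted_sum_eq_piece\<close>.\<close>

lemma f_extremes: "f (X 0) + f (X (n - 1)) = real n * (X (n - 1) - X 0)"
proof -
  have "f (X 0) + f (X (n - 1)) = (\<Sum>i<n. X (n - 1) - X 0)"
    unfolding f_def sum.distrib[symmetric]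
  proof (rule sum.cong)
    fix i assume "i \<in> {..<n}"
    then show "\<bar>X i - X 0\<bar> + \<bar>X i - X (n - 1)\<bar> = X (n - 1) - X 0"
      using X_le[of i "n - 1"] X_le[of 0 i] by simp
  qed simp
  then show ?thesis by simp
qed

section \<open>Greedy choice of the interpolation points\<close>

definition good :: "nat \<Rightarrow> nat \<Rightarrow> bool" where
  "good a b \<longleftrightarrow> (\<forall>k. a < k \<and> k < b \<longrightarrow> chord f (X a) (X b) (X k) \<le> (1 + \<epsilon>) * f (X k))"

lemma good_Suc: "good a (Suc a)"
  by (simp add: good_def)

text \<open>The default \<open>n\<close> is a sentinel for "no further point". The recursion mirrors
  the loop of \<open>search_next\<close>, where each later good index overwrites the earlier
  one.\<close>

primrec last_good :: "nat \<Rightarrow> nat \<Rightarrow> nat" where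
  "last_good a 0 = n"
| "last_good a (Suc j) = (if a < j \<and> good a j then j else last_good a j)"

definition nxt :: "nat \<Rightarrow> nat" where
  "nxt a = last_good a n"

lemma last_good_cases:
  "last_good a j = n \<and> (\<forall>b. a < b \<and> b < j \<longrightarrow> \<not> good a b) \<or>
   a < last_good a j \<and> last_good a j < j \<and> good a (last_good a j)
     \<and> (\<forall>b. last_good a j < b \<and> b < j \<longrightarrow> \<not> good a b)"
  by (induction j) (auto simp: less_Suc_eq)

lemma nxt_last: "n \<le> Suc a \<Longrightarrow> nxt a = n"
  using last_good_cases[of a n] by (auto simp: nxt_def)

text \<open>\<open>Suc a\<close> is always good, so the sentinel cannot occur before the last point.
  The final claim is the maximality on which the count of chosen points rests.\<close>

lemma nxt_good:
  assumes "Suc a < n"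
  shows "a < nxt a" "nxt a < n" "good a (nxt a)" "\<And>b. nxt a < b \<Longrightarrow> b < n \<Longrightarrow> \<not> good a b"
  using last_good_cases[of a n] good_Suc[of a] assms unfolding nxt_def by auto

lemma less_nxt: "a < n \<Longrightarrow> a < nxt a"
  using nxt_last[of a] nxt_good(1)[of a] by (cases "Suc a < n") auto

lemma nxt_le: "nxt a \<le> n"
  using nxt_last[of a] nxt_good(2)[of a] by (cases "Suc a < n") auto

definition pick :: "nat \<Rightarrow> nat" where
  "pick i = (nxt ^^ i) 0"

lemma pick_0: "pick 0 = 0" and pick_Suc: "pick (Suc i) = nxt (pick i)"
  by (simp_all add: pick_def)

definition slope :: "nat \<Rightarrow> real" where
  "slope a = (if nxt a < n then (f (X (nxt a)) - f (X a)) / (X (nxt a) - X a) else real n)"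

text \<open>The slope of the interpolant just left of chosen point number \<open>i\<close>, that of
  the left ray for \<open>i = 0\<close>. Hence \<open>slope_before (Suc i) - slope_before i\<close>
  is the jump at that point.\<close>

definition slope_before :: "nat \<Rightarrow> real" where
  "slope_before i = (case i of 0 \<Rightarrow> - real n | Suc j \<Rightarrow> slope (pick j))"

lemma slope_before_0: "slope_before 0 = - real n" and slope_before_Suc: "slope_before (Suc i) = slope (pick i)"
  by (simp_all add: slope_before_def)

lemma between_points:
  assumes "a < b" "X a \<le> c" "c \<le> X b"
  shows "\<exists>k. a \<le> k \<and> k < b \<and> X k \<le> c \<and> c \<le> X (Suc k)"
  using assms
proof (induction b)
  case (Suc b)
  show ?case
  proof (cases "a < b \<and> c \<le> X b")
    case True
    with Suc show ?thesis by (meson less_SucI)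
  next
    case False
    with Suc show ?thesis by (intro exI[of _ b]) (auto simp: less_Suc_eq)
  qed
qed simp

text \<open>\<open>good\<close> tests data points only. Between consecutive data points both sides
  are affine, so the inequality at the two ends extends to the interval between them.\<close>

lemma chord_le_of_good:
  assumes "a < b" "b < n" "good a b" "X a \<le> c" "c \<le> X b"
  shows "chord f (X a) (X b) c \<le> (1 + \<epsilon>) * f c"
proof -
  obtain k where k: "a \<le> k" "k < b" "X k \<le> c" "c \<le> X (Suc k)"
    using between_points[of a b c] assms by blast
  let ?u = "X k" and ?v = "X (Suc k)"
  have uv: "?u < ?v" using X_less k assms by simp
  \<comment> \<open>The ends \<open>a\<close> and \<open>b\<close>, which \<open>good\<close> leaves
    out, are covered because the chord agrees with \<open>f\<close> there.\<close>
  have at: "chord f (X a) (X b) (X i) \<le> (1 + \<epsilon>) * f (X i)" if "a \<le> i" "i \<le> b" for i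
  proof -
    have "f (X i) \<le> (1 + \<epsilon>) * f (X i)" using f_nonneg eps_pos by (simp add: algebra_simps)
    then show ?thesis
      using that assms X_less[of a b] chord_ends[of "X a" "X b" f]
      by (cases "i = a \<or> i = b") (auto simp: good_def)
  qed
  \<comment> \<open>No data point lies strictly between \<open>?u\<close> and \<open>?v\<close>, so
    \<open>f\<close> is affine there.\<close>
  have "chord f ?u ?v c = f c"
    unfolding chord_f f_def
  proof (rule sum.cong)
    fix i assume "i \<in> {..<n}"
    then have "X i \<le> ?u \<or> ?v \<le> X i" using X_le[of i k] X_le[of "Suc k" i] k assms by force
    then show "chord (\<lambda>x. \<bar>X i - x\<bar>) ?u ?v c = \<bar>X i - c\<bar>"
      using k uv by (intro chord_abs_outside)
  qed simp
  then have fc: "(?v - ?u) * f c = (?v - c) * f ?u + (c - ?u) * f ?v"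
    using uv by (simp add: chord_alt field_simps)
  let ?g = "chord f (X a) (X b)"
  have "(?v - ?u) * ?g c = (?v - c) * ?g ?u + (c - ?u) * ?g ?v"
  proof -
    obtain \<alpha> \<beta> where "?g = (\<lambda>y. \<alpha> + \<beta> * (y - X a))" unfolding chord_def[abs_def] by blast
    then show ?thesis by (simp add: algebra_simps)
  qed
  also have "\<dots> \<le> (?v - c) * ((1 + \<epsilon>) * f ?u) + (c - ?u) * ((1 + \<epsilon>) * f ?v)"
    using at[of k] at[of "Suc k"] k by (intro add_mono mult_left_mono) auto
  also have "\<dots> = (1 + \<epsilon>) * ((?v - c) * f ?u + (c - ?u) * f ?v)"
    by (simp add: algebra_simps)
  also have "\<dots> = (?v - ?u) * ((1 + \<epsilon>) * f c)"
    unfolding fc[symmetric] by (simp only: mult_ac)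
  finally show ?thesis using uv by simp
qed

lemma slope_ge:
  assumes "a < n"
  shows "- real n \<le> slope a"
proof (cases "nxt a < n")
  case True
  then have "X a < X (nxt a)" using X_less less_nxt assms by blast
  then show ?thesis
    using True f_lipschitz[of "X (nxt a)" "X a"] by (simp add: slope_def pos_le_divide_eq)
qed (simp add: slope_def)

text \<open>Convexity puts the middle one of three consecutive chosen points below the chord of the
  outer two. If the middle one is the last, the next slope is \<open>real n\<close>, the Lipschitz
  constant.\<close>

lemma slope_mono:
  assumes "nxt a < n" "a < n"
  shows "slope a \<le> slope (nxt a)"
proof -
  let ?b = "nxt a" let ?c = "nxt ?b"
  have ab: "X a < X ?b" using X_less less_nxt assms by blast
  show ?thesis
  proof (cases "?c < n")
    case True
    then have bc: "X ?b < X ?c" using X_less less_nxt assms by blast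
    have "f (X ?b) \<le> chord f (X a) (X ?c) (X ?b)" using ab bc by (intro f_le_chord) auto
    then have "(X ?c - X a) * f (X ?b) \<le> (X ?c - X ?b) * f (X a) + (X ?b - X a) * f (X ?c)"
      using ab bc by (simp add: chord_alt field_simps)
    then have "(f (X ?b) - f (X a)) * (X ?c - X ?b) \<le> (f (X ?c) - f (X ?b)) * (X ?b - X a)"
      by (simp add: algebra_simps)
    then show ?thesis using True assms ab bc by (simp add: slope_def divide_simps mult_ac)
  next
    case False
    then show ?thesis
      using ab assms f_lipschitz[of "X ?b" "X a"] by (simp add: slope_def pos_divide_le_eq)
  qed
qed

text \<open>This is the nonnegativity of the weights.\<close>

lemma slope_before_mono:
  assumes "pick i < n"
  shows "slope_before i \<le> slope_before (Suc i)"
proof (cases i)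
  case 0
  then show ?thesis using assms slope_ge by (simp add: slope_before_0 slope_before_Suc)
next
  case (Suc j)
  have "pick j < n"
    using assms nxt_last[of "pick j"] by (cases "pick j < n") (auto simp: Suc pick_Suc)
  with Suc assms show ?thesis by (simp add: slope_before_Suc pick_Suc slope_mono)
qed

end

section \<open>The interpolant as a weighted sum of distances\<close>

locale greedy_chain = sorted_points +
  fixes m
  assumes pick_m: "pick m = n" and pick_less_n: "\<And>i. i < m \<Longrightarrow> pick i < n"
begin

lemma pick_less: "i < j \<Longrightarrow> j \<le> m \<Longrightarrow> pick i < pick j"
proof (induction j)
  case (Suc j)
  then have "pick j < pick (Suc j)" using less_nxt pick_less_n by (simp add: pick_Suc)
  with Suc show ?case by (cases "i = j") auto
qed simp

lemma pick_le: "i \<le> j \<Longrightarrow> j \<le> m \<Longrightarrow> pick i \<le> pick j"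
  using pick_less[of i j] by (cases "i = j") auto

text \<open>Among the indices below \<open>n\<close>, only the last one is sent to the sentinel by
  \<open>nxt\<close>. With \<open>pick_0\<close>, both extremes are chosen.\<close>

lemma pick_last: "0 < m \<Longrightarrow> pick (m - 1) = n - 1"
  using nxt_good(2)[of "pick (m - 1)"] pick_less_n[of "m - 1"] pick_m pick_Suc[of "m - 1"]
  by (cases "Suc (pick (m - 1)) < n") auto

lemma pick_good:
  assumes "Suc i < m"
  shows "good (pick i) (pick (Suc i))"
proof -
  have "Suc (pick i) < n" using pick_less[of i "Suc i"] pick_less_n[of "Suc i"] assms by simp
  then show ?thesis by (simp add: pick_Suc nxt_good)
qed

lemma m_pos: "0 < n \<Longrightarrow> 0 < m"
  using pick_m pick_0 by (cases m) auto

text \<open>The affine pieces of the interpolant, numbered so that piece \<open>i\<close> ends at \<open>X (pick i)\<close> and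
  piece \<open>Suc i\<close> starts there.\<close>

definition piece :: "real \<Rightarrow> nat \<Rightarrow> real" where
  "piece c i = (case i of 0 \<Rightarrow> f (X 0) - real n * (c - X 0)
     | Suc j \<Rightarrow> f (X (pick j)) + slope_before (Suc j) * (c - X (pick j)))"

lemma piece_chord:
  assumes "Suc i < m"
  shows "piece c (Suc i) = chord f (X (pick i)) (X (pick (Suc i))) c"
  using assms pick_less_n[of "Suc i"] by (simp add: piece_def slope_before_Suc slope_def pick_Suc chord_def)

lemma piece_end:
  assumes "i < m"
  shows "piece c i = f (X (pick i)) + slope_before i * (c - X (pick i))"
proof (cases i)
  case 0
  then show ?thesis by (simp add: piece_def pick_0 slope_before_0)
next
  case (Suc j)
  then have "X (pick j) < X (pick i)" using pick_less[of j i] pick_less_n[of i] assms X_less by auto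
  then show ?thesis
    using Suc assms pick_less_n[of i] by (simp add: piece_def slope_before_Suc slope_def pick_Suc field_simps)
qed

text \<open>Adjacent pieces meet at \<open>X (pick i)\<close>, so they differ by the jump of the
  slope times the signed distance.\<close>

lemma piece_diff: "i < m \<Longrightarrow> piece c (Suc i) - piece c i = (slope_before (Suc i) - slope_before i) * (c - X (pick i))"
  by (simp add: piece_end algebra_simps) (simp add: piece_def algebra_simps)

text \<open>The distance to \<open>c\<close> is \<open>c - X (pick i)\<close> for chosen points on
  the left and its negative on the right, so by \<open>piece_diff\<close> both parts telescope. What
  remains is \<open>2 * piece c j\<close> minus the two rays, which cancel.\<close>

lemma weighted_sum_eq_piece:
  assumes "0 < n" "j \<le> m" "\<And>i. i < j \<Longrightarrow> X (pick i) \<le> c" "\<And>i. j \<le> i \<Longrightarrow> i < m \<Longrightarrow> c \<le> X (pick i)"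
  shows "(\<Sum>i<m. (slope_before (Suc i) - slope_before i) / 2 * \<bar>X (pick i) - c\<bar>) = piece c j"
proof -
  have split: "{..<m} = {..<j} \<union> {j..<m}" using assms by auto
  have low: "(\<Sum>i<j. (slope_before (Suc i) - slope_before i) * \<bar>X (pick i) - c\<bar>) = (\<Sum>i<j. piece c (Suc i) - piece c i)"
    using assms by (intro sum.cong) (auto simp: piece_diff)
  have high: "(\<Sum>i=j..<m. (slope_before (Suc i) - slope_before i) * \<bar>X (pick i) - c\<bar>) = - (\<Sum>i=j..<m. piece c (Suc i) - piece c i)"
    unfolding sum_negf[symmetric] using assms
    by (intro sum.cong) (auto simp: piece_diff algebra_simps)
  have "(\<Sum>i<m. (slope_before (Suc i) - slope_before i) * \<bar>X (pick i) - c\<bar>) = 2 * piece c j - (piece c 0 + piece c m)"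
  proof -
    have "(\<Sum>i<m. (slope_before (Suc i) - slope_before i) * \<bar>X (pick i) - c\<bar>)
        = (\<Sum>i<j. piece c (Suc i) - piece c i) - (\<Sum>i=j..<m. piece c (Suc i) - piece c i)"
      unfolding split by (subst sum.union_disjoint) (use low high in auto)
    then show ?thesis using assms(2) by (simp add: sum_lessThan_telescope sum_Suc_diff')
  qed
  \<comment> \<open>The rays have slopes \<open>- real n\<close> and \<open>real n\<close>, so their
    sum does not depend on \<open>c\<close>; \<open>f_extremes\<close> makes it zero.\<close>
  moreover have "piece c 0 + piece c m = 0"
  proof -
    obtain l where l: "m = Suc l" using m_pos assms(1) gr0_implies_Suc by blast
    have "slope_before m = real n" using pick_m by (simp add: l slope_before_Suc slope_def pick_Suc)
    then show ?thesis
      using pick_last f_extremes l by (simp add: piece_def algebra_simps)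
  qed
  moreover have "(\<Sum>i<m. (slope_before (Suc i) - slope_before i) / 2 * \<bar>X (pick i) - c\<bar>)
      = (\<Sum>i<m. (slope_before (Suc i) - slope_before i) * \<bar>X (pick i) - c\<bar>) / 2"
    by (simp add: sum_divide_distrib)
  ultimately show ?thesis by simp
qed

lemma weighted_sum_bounds:
  fixes c
  defines "g \<equiv> (\<Sum>i<m. (slope_before (Suc i) - slope_before i) / 2 * \<bar>X (pick i) - c\<bar>)"
  shows "f c \<le> g" "g \<le> (1 + \<epsilon>) * f c"
proof -
  have "f c \<le> g \<and> g \<le> (1 + \<epsilon>) * f c"
  proof (cases "0 < n")
    case True
    \<comment> \<open>\<open>j\<close> counts the chosen points left of \<open>c\<close>, so
      \<open>c\<close> belongs to piece \<open>j\<close>. Pieces 0 and \<open>m\<close> are the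
      rays, where the interpolant equals \<open>f\<close>; the others are good chords.\<close>
    define j where "j = (LEAST j. m \<le> j \<or> c \<le> X (pick j))"
    have j: "m \<le> j \<or> c \<le> X (pick j)" unfolding j_def by (rule LeastI[of _ m]) simp
    have jm: "j \<le> m" unfolding j_def by (rule Least_le) simp
    have lt: "X (pick i) < c" if "i < j" for i
      using not_less_Least[OF that[unfolded j_def]] by auto
    have ge: "c \<le> X (pick i)" if "j \<le> i" "i < m" for i
      using j that order.trans[OF _ X_le[OF pick_le pick_less_n]] by (meson less_imp_le not_less order.trans)
    have g: "g = piece c j"
      unfolding g_def using True jm ge lt by (intro weighted_sum_eq_piece) (auto intro: less_imp_le)
    have le: "f c \<le> (1 + \<epsilon>) * f c" using f_nonneg eps_pos by (simp add: algebra_simps)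
    show ?thesis
    proof (cases j)
      case 0
      then have c: "c \<le> X 0" using ge[of 0] m_pos True by (simp add: pick_0)
      have "f c = piece c 0"
        unfolding f_below[OF c] by (simp add: piece_def right_diff_distrib)
      then have "g = f c" using g 0 by simp
      then show ?thesis using le by simp
    next
      case (Suc i)
      show ?thesis
      proof (cases "j = m")
        case True
        have pick_i: "pick i = n - 1" using pick_last True[symmetric] by (simp add: Suc)
        then have c: "X (n - 1) \<le> c" using lt[of i] by (simp add: Suc)
        have "nxt (pick i) = n" using pick_m True[symmetric] by (simp add: Suc pick_Suc)
        then have "slope_before j = real n" by (simp add: Suc slope_before_Suc slope_def)
        moreover have "piece c j = f (X (pick i)) + slope_before j * (c - X (pick i))"
          by (simp add: Suc piece_def)
        ultimately have "g = f c" unfolding g f_above[OF c] by (simp only: pick_i)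
        then show ?thesis using le by simp
      next
        case False
        then have im: "Suc i < m" using jm Suc by simp
        have bds: "X (pick i) \<le> c" "c \<le> X (pick (Suc i))"
          using lt[of i] ge[of "Suc i"] im Suc by simp_all
        have lt': "pick i < pick (Suc i)" "pick (Suc i) < n"
          using pick_less[of i "Suc i"] pick_less_n[of "Suc i"] im by simp_all
        show ?thesis
          unfolding g Suc piece_chord[OF im]
          using f_le_chord[OF bds X_less[OF lt']] chord_le_of_good[OF lt' pick_good[OF im] bds] by blast
      qed
    qed
  next
    case False
    then have "m = 0" using pick_m pick_less_n[of 0] pick_0 by (cases m) auto
    moreover have "f c = 0" unfolding f_def using False by simp
    ultimately show ?thesis by (simp only: g_def) simp
  qed
  then show "f c \<le> g" "g \<le> (1 + \<epsilon>) * f c" by auto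
qed

end

subsection \<open>Length of the greedy chain\<close>

lemma sum_two_step:
  fixes h :: "nat \<Rightarrow> real"
  shows "(\<Sum>i<q. h (i + 2) - h i) = h (Suc q) + h q - h 1 - h 0"
  by (induction q) simp_all

text \<open>Steps of two overlap only with their neighbours: if \<open>l\<close> is the first to
  straddle \<open>c\<close>, those from \<open>l + 2\<close> on start beyond
  \<open>c\<close>.\<close>

lemma card_straddling:
  fixes A :: "nat \<Rightarrow> nat"
  assumes mono: "\<And>i j. i \<le> j \<Longrightarrow> j \<le> m \<Longrightarrow> A i \<le> A j"
  shows "card {i. i + 2 < m \<and> A i < c \<and> c < A (i + 2)} \<le> 2"
proof (cases "\<exists>i. i + 2 < m \<and> A i < c \<and> c < A (i + 2)")
  case True
  define l where "l = (LEAST i. i + 2 < m \<and> A i < c \<and> c < A (i + 2))"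
  have l: "l + 2 < m \<and> A l < c \<and> c < A (l + 2)"
    unfolding l_def using True by (rule LeastI_ex)
  have sub: "{i. i + 2 < m \<and> A i < c \<and> c < A (i + 2)} \<subseteq> {l, Suc l}"
  proof
    fix i assume "i \<in> {i. i + 2 < m \<and> A i < c \<and> c < A (i + 2)}"
    then have i: "i + 2 < m \<and> A i < c \<and> c < A (i + 2)" by (rule CollectD)
    then have "l \<le> i" unfolding l_def by (rule Least_le)
    moreover have "\<not> l + 2 \<le> i"
    proof
      assume "l + 2 \<le> i"
      then have "A (l + 2) \<le> A i" by (rule mono) (use i in linarith)
      then show False using i l by linarith
    qed
    ultimately have "i = l \<or> i = Suc l" by linarith
    then show "i \<in> {l, Suc l}" by blast
  qed
  have "card {i. i + 2 < m \<and> A i < c \<and> c < A (i + 2)} \<le> card {l, Suc l}"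
    by (rule card_mono[OF _ sub]) simp
  also have "\<dots> = 2" by simp
  finally show ?thesis .
next
  case False
  then have "{i. i + 2 < m \<and> A i < c \<and> c < A (i + 2)} = {}" by blast
  then show ?thesis by (simp only: card.empty)
qed

context greedy_chain
begin

text \<open>By maximality the greedy choice rejected the index after \<open>pick (Suc i)\<close>.
  That index is at most \<open>pick (i + 2)\<close>, which is why the count uses overlapping steps
  of two.\<close>

lemma bad_chord:
  assumes "i + 2 < m"
  obtains k where "pick i < k" "k \<le> pick (Suc i)" "pick (Suc i) < pick (i + 2)"
    "(1 + \<epsilon>) * f (X k) < chord f (X (pick i)) (X (Suc (pick (Suc i)))) (X k)"
proof -
  have lt: "pick i < pick (Suc i)" "pick (Suc i) < pick (i + 2)" "pick (i + 2) < n"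
    using pick_less pick_less_n assms by auto
  then have "\<not> good (pick i) (Suc (pick (Suc i)))"
    using nxt_good(4)[of "pick i" "Suc (pick (Suc i))"] by (simp add: pick_Suc)
  with lt that show ?thesis by (auto simp: good_def not_le)
qed

text \<open>At a violated point \<open>y\<close> the excess is more than
  \<open>\<epsilon> * f y\<close>, while the separated gap bound limits the contribution of each
  kink. The constant 12 is 4 from the gap bound times 3 from
  \<open>real n * D y \<le> 3 * f y\<close>, after which \<open>f y\<close> cancels.\<close>

lemma bad_chord_bound:
  fixes kz R
  defines "z \<equiv> X kz"
  defines "D \<equiv> (\<lambda>x. R + \<bar>x - z\<bar>)"
  defines "\<phi> \<equiv> (\<lambda>x. (x - z) / D x)"
  assumes kz: "kz < n" and min: "\<And>k. k < n \<Longrightarrow> f z \<le> f (X k)" and R: "f z = real n * R" "0 < R"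
    and i: "i + 2 < m" and side: "kz \<le> pick i \<or> pick (i + 2) \<le> kz"
  shows "\<epsilon> < 12 * (\<phi> (X (pick (i + 2))) - \<phi> (X (pick i)))
    * ((\<Sum>j=pick i..<pick (i + 2). D (X j)) / (real n * R))"
proof -
  obtain k where k: "pick i < k" "k \<le> pick (Suc i)" "pick (Suc i) < pick (i + 2)"
    and bad: "(1 + \<epsilon>) * f (X k) < chord f (X (pick i)) (X (Suc (pick (Suc i)))) (X k)"
    using bad_chord[OF i] by blast
  have An: "pick (i + 2) < n" using pick_less_n i by simp
  define b where "b = Suc (pick (Suc i))"
  have b: "b \<le> pick (i + 2)" "k < b" "b < n" using k An by (auto simp: b_def)
  let ?u = "X (pick i)" and ?v = "X b" and ?w = "X (pick (i + 2))" and ?y = "X k"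
  have uyv: "?u < ?y" "?y < ?v" "?v \<le> ?w"
    using k b An by (auto intro!: X_less X_le simp del: add_2_eq_Suc')
  have zside: "z \<le> ?u \<or> ?v \<le> z"
    using side X_le[of kz "pick i"] X_le[of b kz] kz b k unfolding z_def by linarith
  have n: "0 < n" using kz by simp
  have Dpos: "0 < D x" for x using R unfolding D_def by (simp add: add_pos_nonneg)
  let ?\<Delta> = "(?v - ?u) / (D ?u * D ?v)"
  let ?gap = "\<lambda>j. chord (\<lambda>x. \<bar>X j - x\<bar>) ?u ?v ?y - \<bar>X j - ?y\<bar>"
  have \<Delta>_nonneg: "0 \<le> ?\<Delta>" using uyv Dpos[of ?u] Dpos[of ?v] by simp
  \<comment> \<open>Kinks outside the chord contribute nothing. The bound is spread over the longer
    range up to \<open>pick (i + 2)\<close> so that the sums telescope in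
    \<open>length_bound\<close>.\<close>
  have gap: "?gap j \<le> (if j \<in> {pick i..<pick (i + 2)} then 4 * D ?y * D (X j) * ?\<Delta> else 0)"
    if "j < n" for j
  proof (cases "pick i < j \<and> j < b")
    case True
    then have j: "?u \<le> X j" "X j \<le> ?v" using X_le[of "pick i" j] X_le[of j b] b that by simp_all
    from zside have "?gap j \<le> 4 * D ?y * D (X j) * ?\<Delta>"
    proof
      assume "z \<le> ?u"
      then show ?thesis unfolding D_def using j uyv R by (intro chord_abs_gap_right) simp_all
    next
      assume "?v \<le> z"
      then show ?thesis unfolding D_def using j uyv R by (intro chord_abs_gap_left) simp_all
    qed
    moreover have "j \<in> {pick i..<pick (i + 2)}" using True b by simp
    ultimately show ?thesis by (simp only: if_True)
  next
    case False
    then have "X j \<le> ?u \<or> ?v \<le> X j" using X_le[of j "pick i"] X_le[of b j] b that k by linarith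
    then have "?gap j = 0" using uyv by (simp add: chord_abs_outside)
    moreover have "0 \<le> 4 * D ?y * D (X j) * ?\<Delta>"
      using less_imp_le[OF Dpos] \<Delta>_nonneg by (intro mult_nonneg_nonneg) auto
    ultimately show ?thesis
      by (cases "j \<in> {pick i..<pick (i + 2)}") (simp_all only: if_True if_False order_refl)
  qed
  have "\<epsilon> * f ?y < chord f ?u ?v ?y - f ?y"
    using bad unfolding b_def by (simp add: algebra_simps)
  also have "\<dots> = (\<Sum>j<n. ?gap j)"
    unfolding chord_f sum_subtractf by (simp add: f_def)
  also have "\<dots> \<le> (\<Sum>j<n. if j \<in> {pick i..<pick (i + 2)} then 4 * D ?y * D (X j) * ?\<Delta> else 0)"
    by (intro sum_mono gap) simp
  also have "\<dots> = (\<Sum>j=pick i..<pick (i + 2). 4 * D ?y * D (X j) * ?\<Delta>)"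
    using An by (intro sum.mono_neutral_cong_right) auto
  also have "\<dots> = 4 * D ?y * ?\<Delta> * (\<Sum>j=pick i..<pick (i + 2). D (X j))"
    unfolding sum_distrib_left by (intro sum.cong refl) (simp only: mult_ac)
  finally have 1: "\<epsilon> * f ?y < 4 * D ?y * ?\<Delta> * (\<Sum>j=pick i..<pick (i + 2). D (X j))" .
  let ?\<psi> = "\<Sum>j=pick i..<pick (i + 2). D (X j)"
  have \<psi>_nonneg: "0 \<le> ?\<psi>" using Dpos by (intro sum_nonneg) (auto intro: less_imp_le)
  \<comment> \<open>The triangle inequality through every data point gives
    \<open>f ?y + f z\<close>, and \<open>f z\<close> is minimal.\<close>
  have far: "real n * \<bar>?y - z\<bar> \<le> 2 * f ?y"
  proof -
    have "real n * \<bar>?y - z\<bar> = (\<Sum>j<n. \<bar>?y - z\<bar>)" by simp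
    also have "\<dots> \<le> (\<Sum>j<n. \<bar>X j - ?y\<bar> + \<bar>X j - z\<bar>)" by (rule sum_mono) linarith
    also have "\<dots> = f ?y + f z" by (simp add: f_def sum.distrib)
    finally show ?thesis using min[of k] b by simp
  qed
  have fz_pos: "0 < f z" using R n by simp
  have nD: "real n * D ?y \<le> 3 * f ?y"
    using far min[of k] b R by (simp add: D_def algebra_simps)
  have fy: "0 < f ?y" using fz_pos min[of k] b by simp
  have "R * ?\<Delta> \<le> \<phi> ?v - \<phi> ?u"
    unfolding \<phi>_def D_def using R uyv by (intro hyperbolic_increment) auto
  also have "\<phi> ?v \<le> \<phi> ?w"
  proof (cases "?v = ?w")
    case False
    then have "?v < ?w" using uyv by simp
    moreover have "0 \<le> R * ((?w - ?v) / (D ?v * D ?w))"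
      using uyv R Dpos[of ?v] Dpos[of ?w] by simp
    ultimately show ?thesis
      using hyperbolic_increment[of R ?v ?w z] R unfolding \<phi>_def D_def by linarith
  qed simp
  finally have \<phi>: "R * ?\<Delta> \<le> \<phi> ?w - \<phi> ?u" by simp
  \<comment> \<open>The factor \<open>real n * R\<close> regroups the product into
    \<open>real n * D ?y\<close> and \<open>R * ?\<Delta>\<close>, which \<open>nD\<close> and
    \<open>\<phi>\<close> bound.\<close>
  have "(real n * R) * (\<epsilon> * f ?y) < (real n * R) * (4 * D ?y * ?\<Delta> * ?\<psi>)"
    using 1 n R by (intro mult_strict_left_mono) auto
  also have "\<dots> = 4 * ((real n * D ?y) * ((R * ?\<Delta>) * ?\<psi>))"
    by (simp only: mult_ac)
  also have "\<dots> \<le> 4 * ((3 * f ?y) * ((\<phi> ?w - \<phi> ?u) * ?\<psi>))"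
  proof -
    have "0 \<le> R * ?\<Delta> * ?\<psi>" using R \<Delta>_nonneg \<psi>_nonneg by (intro mult_nonneg_nonneg) auto
    then have "(real n * D ?y) * ((R * ?\<Delta>) * ?\<psi>) \<le> (3 * f ?y) * ((\<phi> ?w - \<phi> ?u) * ?\<psi>)"
      using fy by (intro mult_mono[OF nD] mult_right_mono[OF \<phi> \<psi>_nonneg]) auto
    then show ?thesis by simp
  qed
  finally have "f ?y * (real n * R * \<epsilon>) < f ?y * (12 * (\<phi> ?w - \<phi> ?u) * ?\<psi>)"
    by (simp only: mult_ac)
  then have "real n * R * \<epsilon> < 12 * (\<phi> ?w - \<phi> ?u) * ?\<psi>"
    using fy by (simp only: mult_less_cancel_left_pos)
  moreover have "0 < real n * R" using n R by simp
  ultimately show ?thesis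
    unfolding times_divide_eq_right by (simp only: pos_less_divide_eq mult.commute)
qed

text \<open>Here 20 is 16 + 4: steps of two that do not straddle the minimiser account for 16, and 4
  covers the two final indices together with at most two straddling steps.\<close>

lemma length_bound:
  assumes "\<epsilon> < 1"
  shows "real m * sqrt \<epsilon> \<le> 20"
proof (cases "m \<le> 2")
  case True
  have "real m * sqrt \<epsilon> \<le> 2 * 1" using True assms eps_pos by (intro mult_mono) auto
  then show ?thesis by simp
next
  case False
  have n: "1 < n"
    using pick_less[of 0 1] pick_less_n[of 1] False by simp
  have "\<exists>kz<n. \<forall>k<n. f (X kz) \<le> f (X k)"
    using ex_min_if_finite[of "(\<lambda>k. f (X k)) ` {..<n}"] n by (force simp: not_less)
  then obtain kz where kz: "kz < n" and min: "\<And>k. k < n \<Longrightarrow> f (X kz) \<le> f (X k)" by blast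
  define z R where "z = X kz" and "R = f z / real n"
  have fz: "f z = real n * R" using n by (simp add: R_def)
  have R: "0 < R"
  proof -
    have "\<exists>k<n. X k \<noteq> z" using n kz X_less[of 0 1] unfolding z_def by (metis less_irrefl less_trans zero_less_one)
    then have "0 < f z" unfolding f_def by (auto intro!: sum_pos2)
    then show ?thesis using n by (simp add: R_def)
  qed
  define D where "D = (\<lambda>x. R + \<bar>x - z\<bar>)"
  define \<phi> where "\<phi> = (\<lambda>i. (X (pick i) - z) / D (X (pick i)))"
  define H where "H = (\<lambda>i. (\<Sum>j<pick i. D (X j)) / (real n * R))"
  have Dpos: "0 < D x" for x using R unfolding D_def by (simp add: add_pos_nonneg)
  have \<phi>_bounds: "\<phi> i \<le> 1" "- 1 \<le> \<phi> i" for i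
    using Dpos[of "X (pick i)"] R by (simp_all add: \<phi>_def D_def pos_divide_le_eq pos_le_divide_eq)
  have H_bounds: "0 \<le> H i" "i \<le> m \<Longrightarrow> H i \<le> 2" for i
  proof -
    show "0 \<le> H i" using Dpos R unfolding H_def
      by (intro divide_nonneg_nonneg sum_nonneg) (auto intro: less_imp_le)
    assume "i \<le> m"
    then have "pick i \<le> n" using pick_le[of i m] pick_m by simp
    then have "(\<Sum>j<pick i. D (X j)) \<le> (\<Sum>j<n. D (X j))"
      using Dpos by (intro sum_mono2) (auto intro: less_imp_le)
    \<comment> \<open>The summands \<open>R\<close> give \<open>real n * R\<close>, and the
      distances give \<open>f z\<close>, which is the same number.\<close>
    also have "\<dots> = 2 * (real n * R)" using fz by (simp add: D_def sum.distrib f_def)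
    finally show "H i \<le> 2" using n R by (simp add: H_def pos_divide_le_eq)
  qed
  define q where "q = m - 2"
  define B where "B = {i. i + 2 < m \<and> pick i < kz \<and> kz < pick (i + 2)}"
  have B: "card B \<le> 2" unfolding B_def using pick_le by (rule card_straddling)
  have Bq: "B \<subseteq> {..<q}" by (auto simp: B_def q_def)
  let ?s = "\<lambda>i. 2 * ((\<phi> (i + 2) - \<phi> i) + (H (i + 2) - H i))"
  have increments: "0 \<le> \<phi> (i + 2) - \<phi> i" "0 \<le> H (i + 2) - H i" if "i + 2 < m" for i
  proof -
    let ?u = "X (pick i)" and ?w = "X (pick (i + 2))"
    have "?u < ?w" using X_less pick_less pick_less_n that by simp
    moreover from this have "0 \<le> R * ((?w - ?u) / (D ?u * D ?w))"
      using R Dpos[of ?u] Dpos[of ?w] by simp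
    ultimately show "0 \<le> \<phi> (i + 2) - \<phi> i"
      using hyperbolic_increment[of R ?u ?w z] R unfolding \<phi>_def D_def by linarith
    have "(\<Sum>j<pick i. D (X j)) \<le> (\<Sum>j<pick (i + 2). D (X j))"
      using pick_le[of i "i + 2"] that Dpos by (intro sum_mono2) (auto intro: less_imp_le)
    then show "0 \<le> H (i + 2) - H i"
      using R unfolding H_def diff_divide_distrib[symmetric] by simp
  qed
  have step: "sqrt \<epsilon> \<le> ?s i" if "i \<in> {..<q} - B" for i
  proof -
    have i: "i + 2 < m" and side: "kz \<le> pick i \<or> pick (i + 2) \<le> kz" using that by (auto simp: q_def B_def)
    have "H (i + 2) - H i = (\<Sum>j=pick i..<pick (i + 2). D (X j)) / (real n * R)"
      using sum.atLeastLessThan_concat[of 0 "pick i" "pick (i + 2)" "\<lambda>j. D (X j)"] pick_le[of i "i + 2"] i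
      unfolding H_def diff_divide_distrib[symmetric] by (simp add: lessThan_atLeast0)
    then have lt: "\<epsilon> < 12 * (\<phi> (i + 2) - \<phi> i) * (H (i + 2) - H i)"
      using bad_chord_bound[of kz R i] kz min R fz i side unfolding \<phi>_def D_def z_def by simp
    \<comment> \<open>The difference of the two sides is \<open>2 * ((a - b)^2 + a^2 + b^2)\<close>.
      This form of AM-GM turns the product into a sum that telescopes.\<close>
    have "12 * a * b \<le> (2 * (a + b))\<^sup>2" for a b :: real
    proof -
      have "0 \<le> (a - b)\<^sup>2 + a\<^sup>2 + b\<^sup>2" by simp
      then show ?thesis by (simp add: power2_eq_square algebra_simps)
    qed
    then have "\<epsilon> \<le> (?s i)\<^sup>2" using lt by (meson less_imp_le order.trans)
    then show ?thesis using increments[of i] i by (intro real_le_lsqrt) auto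
  qed
  have "real (card ({..<q} - B)) * sqrt \<epsilon> = (\<Sum>i\<in>{..<q} - B. sqrt \<epsilon>)" by simp
  also have "\<dots> \<le> (\<Sum>i\<in>{..<q} - B. ?s i)" using step by (rule sum_mono)
  also have "\<dots> \<le> (\<Sum>i<q. ?s i)"
    using increments by (intro sum_mono2) (auto simp: q_def less_diff_conv)
  also have "\<dots> = 2 * ((\<Sum>i<q. \<phi> (i + 2) - \<phi> i) + (\<Sum>i<q. H (i + 2) - H i))"
    by (simp only: sum_distrib_left[symmetric] sum.distrib)
  \<comment> \<open>\<open>\<phi>\<close> ranges in \<open>[-1, 1]\<close> and \<open>H\<close> in
    \<open>[0, 2]\<close>, so each two-step sum is at most 4, and the sum of both is
    doubled.\<close>
  also have "\<dots> \<le> 16"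
  proof -
    have "Suc q \<le> m" "q \<le> m" using False by (auto simp: q_def)
    then have "H (Suc q) \<le> 2" "H q \<le> 2" by (auto intro: H_bounds)
    then have "H (Suc q) + H q - H 1 - H 0 \<le> 4" using H_bounds(1)[of 1] H_bounds(1)[of 0] by linarith
    moreover have "\<phi> (Suc q) + \<phi> q - \<phi> 1 - \<phi> 0 \<le> 4"
      using \<phi>_bounds(1)[of "Suc q"] \<phi>_bounds(1)[of q] \<phi>_bounds(2)[of 1] \<phi>_bounds(2)[of 0]
      by linarith
    ultimately have "\<phi> (Suc q) + \<phi> q - \<phi> 1 - \<phi> 0 + (H (Suc q) + H q - H 1 - H 0) \<le> 8"
      by linarith
    then show ?thesis unfolding sum_two_step by simp
  qed
  finally have "real (card ({..<q} - B)) * sqrt \<epsilon> \<le> 16" .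
  moreover have "m \<le> card ({..<q} - B) + 4"
    using B Bq False card_Diff_subset[of B "{..<q}"] finite_subset[OF Bq] by (simp add: q_def)
  then have "real m * sqrt \<epsilon> \<le> (real (card ({..<q} - B)) + 4) * sqrt \<epsilon>"
    using eps_pos by (intro mult_right_mono) auto
  moreover have "sqrt \<epsilon> \<le> 1" using assms by simp
  ultimately show ?thesis unfolding distrib_right by linarith
qed

end

subsection \<open>Step-bounded execution\<close>

text \<open>Total correctness with a time budget; by \<open>exec_deterministic\<close> the run that
  exists is the only halting one.\<close>

definition runs :: "com \<Rightarrow> state \<Rightarrow> nat \<Rightarrow> (state \<Rightarrow> bool) \<Rightarrow> bool" where
  "runs c s K Q \<longleftrightarrow> (\<exists>k t. exec c s k t \<and> k \<le> K \<and> Q t)"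

lemma runsE:
  assumes "runs c s K Q"
  obtains k t where "exec c s k t" "k \<le> K" "Q t"
  using assms by (auto simp: runs_def)

lemma runs_Skip: "Q s \<Longrightarrow> 1 \<le> K \<Longrightarrow> runs Skip s K Q"
  unfolding runs_def by (blast intro: exec.Skip)

lemma runs_SetReg: "Q (set_reg x (ival a s) s) \<Longrightarrow> 1 \<le> K \<Longrightarrow> runs (SetReg x a) s K Q"
  unfolding runs_def by (blast intro: exec.SetReg)

lemma runs_SetCell: "Q (set_cell x (ival i s) (rval a s) s) \<Longrightarrow> 1 \<le> K \<Longrightarrow> runs (SetCell x i a) s K Q"
  unfolding runs_def by (blast intro: exec.SetCell)

lemma runs_Seq:
  assumes "runs c s K P" "\<And>t. P t \<Longrightarrow> runs d t L Q" "K + L \<le> M"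
  shows "runs (Seq c d) s M Q"
proof -
  obtain k s' where 1: "exec c s k s'" "k \<le> K" "P s'" using assms(1) by (rule runsE)
  obtain l t where 2: "exec d s' l t" "l \<le> L" "Q t" using assms(2)[OF 1(3)] by (rule runsE)
  show ?thesis
    unfolding runs_def using exec.Seq[OF 1(1) 2(1)] 1(2) 2(2,3) assms(3)
    by (intro exI[of _ "k + l"] exI[of _ t]) simp
qed

lemma runs_Seq_SetReg:
  "runs d (set_reg x (ival a s) s) (K - 1) Q \<Longrightarrow> 1 \<le> K \<Longrightarrow> runs (Seq (SetReg x a) d) s K Q"
  by (rule runs_Seq[where L = "K - 1", OF runs_SetReg[where Q = "\<lambda>t. t = set_reg x (ival a s) s", OF refl order_refl]]) auto

lemma runs_Seq_SetCell:
  "runs d (set_cell x (ival i s) (rval a s) s) (K - 1) Q \<Longrightarrow> 1 \<le> K \<Longrightarrow> runs (Seq (SetCell x i a) d) s K Q"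
  by (rule runs_Seq[where L = "K - 1", OF runs_SetCell[where Q = "\<lambda>t. t = set_cell x (ival i s) (rval a s) s", OF refl order_refl]])
    auto

lemma runs_Cond:
  assumes "bval b s \<Longrightarrow> runs c s (K - 1) Q" "\<not> bval b s \<Longrightarrow> runs d s (K - 1) Q" "1 \<le> K"
  shows "runs (Cond b c d) s K Q"
proof (cases "bval b s")
  case True
  with assms(1) obtain k t where "exec c s k t" "k \<le> K - 1" "Q t" by (auto elim: runsE)
  with True assms(3) show ?thesis
    unfolding runs_def by (intro exI[of _ "Suc k"] exI[of _ t]) (auto intro: exec.CondTrue)
next
  case False
  with assms(2) obtain k t where "exec d s k t" "k \<le> K - 1" "Q t" by (auto elim: runsE)
  with False assms(3) show ?thesis
    unfolding runs_def by (intro exI[of _ "Suc k"] exI[of _ t]) (auto intro: exec.CondFalse)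
qed

lemma runs_mono: "runs c s K P \<Longrightarrow> K \<le> L \<Longrightarrow> (\<And>t. P t \<Longrightarrow> Q t) \<Longrightarrow> runs c s L Q"
  unfolding runs_def by (meson order.trans)

section \<open>Frame conditions and counting loops\<close>

fun wregs :: "com \<Rightarrow> vname set" where
  "wregs Skip = {}"
| "wregs (SetReg x a) = {x}"
| "wregs (SetCell x i a) = {}"
| "wregs (Seq c d) = wregs c \<union> wregs d"
| "wregs (Cond b c d) = wregs c \<union> wregs d"
| "wregs (While b c) = wregs c"

fun warrs :: "com \<Rightarrow> vname set" where
  "warrs Skip = {}"
| "warrs (SetReg x a) = {}"
| "warrs (SetCell x i a) = {x}"
| "warrs (Seq c d) = warrs c \<union> warrs d"
| "warrs (Cond b c d) = warrs c \<union> warrs d"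
| "warrs (While b c) = warrs c"

definition frame :: "com \<Rightarrow> state \<Rightarrow> state \<Rightarrow> bool" where
  "frame c s t \<longleftrightarrow> (\<forall>x. x \<notin> wregs c \<longrightarrow> regs t x = regs s x) \<and> (\<forall>a. a \<notin> warrs c \<longrightarrow> cells t a = cells s a)"

lemma frame_regs: "frame c s t \<Longrightarrow> x \<notin> wregs c \<Longrightarrow> regs t x = regs s x"
  and frame_cells: "frame c s t \<Longrightarrow> a \<notin> warrs c \<Longrightarrow> cells t a = cells s a"
  by (simp_all add: frame_def)

lemma exec_frame: "exec c s k t \<Longrightarrow> frame c s t"
  by (induction rule: exec.induct) (auto simp: frame_def set_reg_def set_cell_def)

lemma runs_frame: "runs c s K Q \<Longrightarrow> runs c s K (\<lambda>t. Q t \<and> frame c s t)"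
  unfolding runs_def using exec_frame by blast

definition for_loop :: "vname \<Rightarrow> com \<Rightarrow> com" where
  "for_loop i c = Seq (SetReg i (IConst 0))
     (While (ILess (Reg i) (Reg ''n'')) (Seq c (SetReg i (IPlus (Reg i) (IConst 1)))))"

lemma wregs_for_loop [simp]: "wregs (for_loop i c) = insert i (wregs c)"
  and warrs_for_loop [simp]: "warrs (for_loop i c) = warrs c"
  by (auto simp: for_loop_def)

text \<open>Each round costs the body, a test and an increment; the extra 2 are the initial
  assignment and the last, failing test. The invariant must ignore the counter, because the body
  establishes it for \<open>Suc j\<close> before the increment.\<close>

lemma runs_for_loop:
  assumes N: "regs s ''n'' = N"
    and i: "i \<noteq> ''n''" "i \<notin> wregs c" "''n'' \<notin> wregs c"
    and init: "I 0 s"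
    and stable: "\<And>j x t. I j t \<Longrightarrow> I j (set_reg i x t)"
    and body: "\<And>j t. j < N \<Longrightarrow> I j t \<Longrightarrow> regs t i = j \<Longrightarrow> frame (for_loop i c) s t \<Longrightarrow>
      runs c t K (I (Suc j))"
    and M: "(K + 2) * N + 2 \<le> M"
  shows "runs (for_loop i c) s M (\<lambda>t. I N t \<and> frame (for_loop i c) s t)"
proof -
  define inc where "inc = SetReg i (IPlus (Reg i) (IConst 1))"
  define loop where "loop = While (ILess (Reg i) (Reg ''n'')) (Seq c inc)"
  have iter: "runs loop t ((K + 2) * (N - j) + 1) (I N)"
    if "j \<le> N" "I j t" "regs t i = j" "frame (for_loop i c) s t" for j t
    using that
  proof (induction "N - j" arbitrary: j t)
    case 0
    then have "j = N" by simp
    have "regs t ''n'' = N" using 0 N i by (simp add: frame_regs)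
    then have "exec loop t 1 t" unfolding loop_def using 0 by (intro exec.WhileFalse) simp
    with 0 \<open>j = N\<close> show ?case unfolding runs_def by (intro exI[of _ 1] exI[of _ t]) simp
  next
    case (Suc d)
    then have j: "j < N" and d: "d = N - Suc j" by auto
    have n: "regs t ''n'' = N" using Suc N i by (simp add: frame_regs)
    obtain k u where u: "exec c t k u" "k \<le> K" "I (Suc j) u"
      using body[OF j Suc.prems(2-4)] by (rule runsE)
    have fr: "frame c t u" using u(1) by (rule exec_frame)
    define u' where "u' = set_reg i (Suc j) u"
    have "exec inc u 1 u'"
      using exec.SetReg[of i "IPlus (Reg i) (IConst 1)" u] Suc.prems i frame_regs[OF fr]
      by (simp add: inc_def u'_def)
    then have step: "exec (Seq c inc) t (k + 1) u'" using u(1) exec.Seq by blast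
    have "frame (for_loop i c) s u'"
      using Suc.prems(4) fr unfolding frame_def u'_def by (auto simp: set_reg_def)
    moreover have "I (Suc j) u'" unfolding u'_def by (rule stable) (rule u)
    moreover have "regs u' i = Suc j" by (simp add: u'_def set_reg_def)
    ultimately have "runs loop u' ((K + 2) * (N - Suc j) + 1) (I N)"
      using Suc.hyps(1)[OF d] j by simp
    then obtain l v where v: "exec loop u' l v" "l \<le> (K + 2) * (N - Suc j) + 1" "I N v" by (rule runsE)
    have "bval (ILess (Reg i) (Reg ''n'')) t" using n j Suc.prems by simp
    then have "exec loop t (Suc (k + 1 + l)) v"
      unfolding loop_def using step v(1) by (intro exec.WhileTrue) (auto simp: loop_def)
    moreover have "Suc (k + 1 + l) \<le> (K + 2) * (N - j) + 1"
    proof -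
      have "N - j = Suc (N - Suc j)" using j by simp
      then show ?thesis using u(2) v(2) by simp
    qed
    ultimately show ?case using v(3) unfolding runs_def by blast
  qed
  have "runs (for_loop i c) s M (I N)"
    unfolding for_loop_def loop_def[symmetric] inc_def[symmetric]
  proof (rule runs_Seq_SetReg)
    have "runs loop (set_reg i 0 s) ((K + 2) * (N - 0) + 1) (I N)"
      using init by (intro iter stable) (auto simp: frame_def set_reg_def)
    then show "runs loop (set_reg i (ival (IConst 0) s) s) (M - 1) (I N)"
      using M by (auto elim: runs_mono)
  qed (use M in simp)
  then show ?thesis by (rule runs_frame)
qed

subsection \<open>The program\<close>

definition rank :: "(nat \<Rightarrow> real) \<Rightarrow> nat \<Rightarrow> nat \<Rightarrow> nat" where
  "rank p n i = card {j. j < n \<and> p j < p i}"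

lemma rank_mono: "p i < p j \<Longrightarrow> i < n \<Longrightarrow> rank p n i < rank p n j"
  unfolding rank_def by (intro psubset_card_mono) auto

lemma rank_le_iff: "inj_on p {..<n} \<Longrightarrow> i < n \<Longrightarrow> j < n \<Longrightarrow> rank p n i < rank p n j \<longleftrightarrow> p i < p j"
  using rank_mono[of p i j n] rank_mono[of p j i n] inj_onD[of p "{..<n}" i j]
  by (metis lessThan_iff less_asym' less_irrefl linorder_neqE)

lemma rank_less: "i < n \<Longrightarrow> rank p n i < n"
  using psubset_card_mono[of "{..<n}" "{j. j < n \<and> p j < p i}"] by (auto simp: rank_def)

lemma inj_on_rank: "inj_on p {..<n} \<Longrightarrow> inj_on (rank p n) {..<n}"
proof (rule inj_onI)
  fix i j assume "inj_on p {..<n}" and ij: "i \<in> {..<n}" "j \<in> {..<n}" "rank p n i = rank p n j"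
  then have "\<not> p i < p j" "\<not> p j < p i" using rank_mono[of p i j n] rank_mono[of p j i n] by auto
  then have "p i = p j" by simp
  with \<open>inj_on p {..<n}\<close> ij(1,2) show "i = j" by (simp add: inj_onD)
qed

text \<open>For distinct values, \<open>rank\<close> is an injection of \<open>{..<n}\<close> into
  itself and hence a bijection, so every cell below \<open>n\<close> receives a value.\<close>

lemma sorted_by_rank:
  assumes inj: "inj_on p {..<n}" and X: "\<And>i. i < n \<Longrightarrow> X (rank p n i) = p i"
  shows "\<And>r s. r < s \<Longrightarrow> s < n \<Longrightarrow> X r < X s" "X ` {..<n} = p ` {..<n}"
proof -
  have onto: "rank p n ` {..<n} = {..<n}"
    by (rule endo_inj_surj) (auto simp: rank_less inj inj_on_rank)
  have ex: "\<exists>i<n. rank p n i = r" if "r < n" for r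
    using that onto by (metis imageE lessThan_iff)
  show "X r < X s" if rs: "r < s" "s < n" for r s
  proof -
    obtain i j where "i < n" "rank p n i = r" "j < n" "rank p n j = s"
      using ex[of r] ex[of s] rs by auto
    then show ?thesis using rs X rank_le_iff[OF inj] by metis
  qed
  have "X ` {..<n} = X ` rank p n ` {..<n}" by (simp add: onto)
  also have "\<dots> = p ` {..<n}" by (auto simp: image_image X)
  finally show "X ` {..<n} = p ` {..<n}" .
qed

definition rank_sort :: com where
  "rank_sort = for_loop ''i'' (Seq (SetReg ''r'' (IConst 0)) (Seq
     (for_loop ''j'' (Cond (RLess (Cell ''P'' (Reg ''j'')) (Cell ''P'' (Reg ''i'')))
       (SetReg ''r'' (IPlus (Reg ''r'') (IConst 1))) Skip))
     (SetCell ''X'' (Reg ''r'') (Cell ''P'' (Reg ''i'')))))"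

lemma runs_rank_sort:
  assumes n: "regs s ''n'' = n" and p: "\<And>i. cells s ''P'' i = p i" and inj: "inj_on p {..<n}"
  shows "runs rank_sort s ((5 * n + 10) * n + 2)
    (\<lambda>t. (\<forall>i<n. cells t ''X'' (rank p n i) = p i) \<and> frame rank_sort s t)"
  unfolding rank_sort_def
proof (rule runs_for_loop[where K = "5 * n + 5" and I = "\<lambda>j t. \<forall>i<j. cells t ''X'' (rank p n i) = p i"], goal_cases)
  \<comment> \<open>Case 7 is the obligation for the loop body; \<open>7(4)\<close> is the frame
    fact that keeps the input intact.\<close>
  case (7 i t)
  have tP: "cells t ''P'' = p" using 7(4) p by (auto simp: frame_def fun_eq_iff)
  have tn: "regs t ''n'' = n" using 7(4) n by (simp add: frame_def)
  show ?case
  proof (intro runs_Seq_SetReg, rule runs_Seq[where K = "5 * n + 2" and L = 1], rule runs_for_loop[where K = 3 and N = n and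
      I = "\<lambda>j u. regs u ''r'' = card {l. l < j \<and> p l < p i}"], goal_cases)
    case (7 j u)
    have "cells u ''P'' = p" "regs u ''i'' = i"
      using 7(4) tP \<open>regs t ''i'' = i\<close> by (auto simp: frame_def set_reg_def)
    moreover have "{l. l < Suc j \<and> p l < p i}
        = (if p j < p i then insert j {l. l < j \<and> p l < p i} else {l. l < j \<and> p l < p i})"
      by (auto simp: less_Suc_eq)
    ultimately show ?case using 7
      by (intro runs_Cond runs_SetReg runs_Skip) (auto simp: set_reg_def)
  next
    case (9 u)
    then have "cells u = cells t" "regs u ''i'' = i" "regs u ''r'' = rank p n i"
      using \<open>regs t ''i'' = i\<close> by (auto simp: frame_def set_reg_def rank_def)
    moreover have "rank p n l \<noteq> rank p n i" if "l < i" for l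
      using inj_on_rank[OF inj] that \<open>i < n\<close> by (auto dest: inj_onD)
    ultimately show ?case using tP 7(2)
      by (intro runs_SetCell) (auto simp: set_cell_def less_Suc_eq)
  qed (use tn in \<open>auto simp: set_reg_def\<close>)
qed (use n in \<open>auto simp: set_reg_def\<close>)

text \<open>Absolute values are formed by comparison. Cell \<open>N\<close> counts the points as a
  real number, since the machine cannot convert an index.\<close>

definition tabulate_cost :: com where
  "tabulate_cost = for_loop ''i'' (Seq (SetCell ''F'' (Reg ''i'') (RConst 0)) (Seq
     (SetCell ''N'' (IConst 0) (RPlus (Cell ''N'' (IConst 0)) (RConst 1)))
     (for_loop ''j'' (Cond (RLess (Cell ''X'' (Reg ''i'')) (Cell ''X'' (Reg ''j'')))
       (SetCell ''F'' (Reg ''i'') (RPlus (Cell ''F'' (Reg ''i''))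
          (RMinus (Cell ''X'' (Reg ''j'')) (Cell ''X'' (Reg ''i'')))))
       (SetCell ''F'' (Reg ''i'') (RPlus (Cell ''F'' (Reg ''i''))
          (RMinus (Cell ''X'' (Reg ''i'')) (Cell ''X'' (Reg ''j'')))))))))"

lemma runs_tabulate_cost:
  assumes n: "regs s ''n'' = n" and X: "cells s ''X'' = X" and N: "cells s ''N'' 0 = 0"
  shows "runs tabulate_cost s ((5 * n + 10) * n + 2)
    (\<lambda>t. ((\<forall>i<n. cells t ''F'' i = (\<Sum>j<n. \<bar>X j - X i\<bar>)) \<and> cells t ''N'' 0 = real n)
      \<and> frame tabulate_cost s t)"
  unfolding tabulate_cost_def
proof (rule runs_for_loop[where K = "5 * n + 5" and I = "\<lambda>i t.
    (\<forall>l<i. cells t ''F'' l = (\<Sum>j<n. \<bar>X j - X l\<bar>)) \<and> cells t ''N'' 0 = real i"], goal_cases)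
  case (7 i t)
  have tX: "cells t ''X'' = X" using 7(4) X by (auto simp: frame_def fun_eq_iff)
  have tn: "regs t ''n'' = n" using 7(4) n by (simp add: frame_def)
  show ?case
  proof (intro runs_Seq_SetCell, rule runs_mono, rule runs_for_loop[where K = 3 and N = n and M = "5 * n + 2" and
      I = "\<lambda>j u. cells u ''F'' i = (\<Sum>l<j. \<bar>X l - X i\<bar>) \<and> (\<forall>l. l \<noteq> i \<longrightarrow> cells u ''F'' l = cells t ''F'' l)"], goal_cases)
    case (7 j u)
    have "cells u ''X'' = X" "regs u ''i'' = i"
      using 7(4) tX \<open>regs t ''i'' = i\<close> by (auto simp: frame_def set_cell_def)
    then show ?case using 7
      by (intro runs_Cond runs_SetCell) (auto simp: set_cell_def)
  next
    case (10 u)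
    then have "cells u ''N'' 0 = real i + 1"
      using 7(2) by (auto simp: frame_def set_cell_def)
    then show ?case using 10 7(2) by (auto simp: less_Suc_eq)
  qed (use tn \<open>regs t ''i'' = i\<close> in \<open>auto simp: set_cell_def set_reg_def\<close>)
qed (use n N in \<open>auto simp: set_reg_def\<close>)

definition chord_exp :: rexp where
  "chord_exp = RPlus (Cell ''F'' (Reg ''a'')) (RTimes
     (RDiv (RMinus (Cell ''F'' (Reg ''j'')) (Cell ''F'' (Reg ''a'')))
       (RMinus (Cell ''X'' (Reg ''j'')) (Cell ''X'' (Reg ''a''))))
     (RMinus (Cell ''X'' (Reg ''k'')) (Cell ''X'' (Reg ''a''))))"

definition test_chord :: com where
  "test_chord = Seq (SetReg ''g'' (IConst 0)) (for_loop ''k''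
     (Cond (BAnd (ILess (Reg ''a'') (Reg ''k'')) (BAnd (ILess (Reg ''k'') (Reg ''j''))
         (RLess (RTimes (RPlus (RConst 1) (Cell ''eps'' (IConst 0))) (Cell ''F'' (Reg ''k''))) chord_exp)))
       (SetReg ''g'' (IConst 1)) Skip))"

definition search_next :: com where
  "search_next = Seq (SetReg ''b'' (Reg ''n'')) (for_loop ''j''
     (Cond (ILess (Reg ''a'') (Reg ''j''))
       (Seq test_chord (Cond (ILess (Reg ''g'') (IConst 1)) (SetReg ''b'' (Reg ''j'')) Skip)) Skip))"

text \<open>\<open>D\<close> holds the slope leaving the current point and \<open>L\<close> the
  slope arriving there; the weight is stored before \<open>L\<close> is overwritten.\<close>

definition greedy_step :: com where
  "greedy_step = Seq search_next (Seq
     (Cond (ILess (Reg ''b'') (Reg ''n''))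
       (SetCell ''D'' (IConst 0)
         (RDiv (RMinus (Cell ''F'' (Reg ''b'')) (Cell ''F'' (Reg ''a'')))
           (RMinus (Cell ''X'' (Reg ''b'')) (Cell ''X'' (Reg ''a'')))))
       (SetCell ''D'' (IConst 0) (Cell ''N'' (IConst 0))))
     (Seq (SetCell ''S'' (Reg ''m'') (Cell ''X'' (Reg ''a'')))
     (Seq (SetCell ''W'' (Reg ''m'')
         (RDiv (RMinus (Cell ''D'' (IConst 0)) (Cell ''L'' (IConst 0))) (RConst 2)))
     (Seq (SetCell ''L'' (IConst 0) (Cell ''D'' (IConst 0)))
     (Seq (SetReg ''m'' (IPlus (Reg ''m'') (IConst 1))) (SetReg ''a'' (Reg ''b'')))))))"

text \<open>Every active round advances \<open>a\<close>, so \<open>n\<close> rounds suffice and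
  surplus rounds do nothing. The fixed number of rounds makes \<open>runs_for_loop\<close>
  applicable.\<close>

definition greedy :: com where
  "greedy = for_loop ''t'' (Cond (ILess (Reg ''a'') (Reg ''n'')) greedy_step Skip)"

definition coreset_program :: com where
  "coreset_program = Seq rank_sort (Seq tabulate_cost
     (Seq (SetCell ''L'' (IConst 0) (RMinus (RConst 0) (Cell ''N'' (IConst 0)))) greedy))"

section \<open>Correctness and running time of the greedy loop\<close>

context sorted_points
begin

definition ready :: "state \<Rightarrow> bool" where
  "ready s \<longleftrightarrow> regs s ''n'' = n \<and> cells s ''X'' = X \<and> (\<forall>i<n. cells s ''F'' i = f (X i))
     \<and> cells s ''eps'' 0 = \<epsilon> \<and> cells s ''N'' 0 = real n"

lemma ready_frame:
  assumes "ready s" "frame c s t" "''n'' \<notin> wregs c" "{''X'', ''F'', ''eps'', ''N''} \<inter> warrs c = {}"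
  shows "ready t"
  using assms unfolding ready_def frame_def by auto

lemma runs_test_chord:
  assumes s: "ready s" and a: "regs s ''a'' = a" "a < n" and j: "regs s ''j'' = j" "j < n"
  shows "runs test_chord s (4 * n + 3) (\<lambda>t. (regs t ''g'' = 0 \<longleftrightarrow> good a j) \<and> frame test_chord s t)"
proof -
  let ?bad = "\<lambda>l. a < l \<and> l < j \<and> (1 + \<epsilon>) * f (X l) < chord f (X a) (X j) (X l)"
  have "runs test_chord s (4 * n + 3) (\<lambda>t. regs t ''g'' = 0 \<longleftrightarrow> good a j)"
    unfolding test_chord_def
  proof (rule runs_Seq_SetReg, rule runs_mono, rule runs_for_loop[where K = 2 and N = n and M = "4 * n + 2" and
      I = "\<lambda>k u. regs u ''g'' = 0 \<longleftrightarrow> (\<forall>l<k. \<not> ?bad l)"], goal_cases)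
    case (7 k u)
    have "ready (set_reg ''g'' 0 s)" using s by (simp add: ready_def set_reg_def)
    then have u: "ready u" by (rule ready_frame) (use 7(4) in auto)
    have r: "regs u ''a'' = a" "regs u ''j'' = j"
      using 7(4) a j by (auto simp: frame_def set_reg_def)
    have "rval chord_exp u = chord f (X a) (X j) (X k)"
      using u r 7 a j by (simp add: chord_exp_def chord_def ready_def)
    then show ?case
      using 7 u r j by (intro runs_Cond runs_SetReg runs_Skip) (auto simp: ready_def set_reg_def less_Suc_eq)
  next
    case (10 t)
    moreover have "(\<forall>l<n. \<not> ?bad l) \<longleftrightarrow> good a j"
      using j unfolding good_def by (meson less_trans not_less)
    ultimately show ?case by blast
  qed (use s in \<open>auto simp: set_reg_def ready_def\<close>)
  then show ?thesis by (rule runs_frame)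
qed

text \<open>The register \<open>b\<close> follows the recursion of \<open>last_good\<close>,
  starting from the sentinel \<open>n\<close>.\<close>

lemma runs_search_next:
  assumes s: "ready s" and a: "regs s ''a'' = a" "a < n"
  shows "runs search_next s ((4 * n + 8) * n + 3) (\<lambda>t. regs t ''b'' = nxt a \<and> frame search_next s t)"
proof -
  have "runs search_next s ((4 * n + 8) * n + 3) (\<lambda>t. regs t ''b'' = nxt a)"
    unfolding search_next_def
  proof (rule runs_Seq_SetReg, rule runs_mono, rule runs_for_loop[where K = "4 * n + 6" and N = n and
      M = "(4 * n + 8) * n + 2" and I = "\<lambda>j u. regs u ''b'' = last_good a j"], goal_cases)
    case (7 j u)
    have "ready (set_reg ''b'' n s)" using s by (simp add: ready_def set_reg_def)
    then have u: "ready u"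
      by (rule ready_frame) (use 7(4) s in \<open>auto simp: test_chord_def ready_def\<close>)
    have r: "regs u ''a'' = a" "regs u ''j'' = j"
      using 7(3,4) a by (auto simp: frame_def set_reg_def test_chord_def)
    show ?case
    proof (rule runs_Cond)
      assume less: "bval (ILess (Reg ''a'') (Reg ''j'')) u"
      show "runs (Seq test_chord (Cond (ILess (Reg ''g'') (IConst 1)) (SetReg ''b'' (Reg ''j'')) Skip)) u
        (4 * n + 6 - 1) (\<lambda>u. regs u ''b'' = last_good a (Suc j))"
      proof (rule runs_Seq[where L = 2, OF runs_test_chord[OF u r(1) a(2) r(2) 7(1)]])
        fix v assume v: "(regs v ''g'' = 0 \<longleftrightarrow> good a j) \<and> frame test_chord u v"
        then have "regs v ''j'' = j" "regs v ''b'' = last_good a j"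
          using 7(2) r by (auto simp: frame_def test_chord_def)
        then show "runs (Cond (ILess (Reg ''g'') (IConst 1)) (SetReg ''b'' (Reg ''j'')) Skip) v 2
            (\<lambda>u. regs u ''b'' = last_good a (Suc j))"
          using v less r by (intro runs_Cond runs_SetReg runs_Skip) (auto simp: set_reg_def)
      qed simp
    next
      assume "\<not> bval (ILess (Reg ''a'') (Reg ''j'')) u"
      then show "runs Skip u (4 * n + 6 - 1) (\<lambda>u. regs u ''b'' = last_good a (Suc j))"
        using 7(2) r by (intro runs_Skip) auto
    qed simp
  qed (use s in \<open>auto simp: set_reg_def ready_def test_chord_def nxt_def\<close>)
  then show ?thesis by (rule runs_frame)
qed

text \<open>The conjunct \<open>pick i < n\<close> records that the chain has not ended earlier, as
  required to instantiate \<open>greedy_chain\<close> with the final \<open>m\<close>.\<close>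

definition chain_state :: "nat \<Rightarrow> state \<Rightarrow> bool" where
  "chain_state m s \<longleftrightarrow> regs s ''m'' = m \<and> regs s ''a'' = pick m \<and> cells s ''L'' 0 = slope_before m \<and>
     (\<forall>i<m. pick i < n \<and> cells s ''S'' i = X (pick i) \<and> cells s ''W'' i = (slope_before (Suc i) - slope_before i) / 2)"

lemma runs_greedy_step:
  assumes s: "ready s" and m: "chain_state m s" and pick_m: "pick m < n"
  shows "runs greedy_step s ((4 * n + 8) * n + 10) (chain_state (Suc m))"
  unfolding greedy_step_def
proof (rule runs_Seq[where L = 7, OF runs_search_next[OF s]])
  show "regs s ''a'' = pick m" "pick m < n" using m pick_m by (auto simp: chain_state_def)
  fix u assume u: "regs u ''b'' = nxt (pick m) \<and> frame search_next s u"
  have ready_u: "ready u"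
    by (rule ready_frame[OF s, of search_next]) (use u in \<open>auto simp: search_next_def test_chord_def\<close>)
  have chain_u: "chain_state m u"
    using u m by (auto simp: chain_state_def frame_def search_next_def test_chord_def)
  let ?d = "slope_before (Suc m)"
  show "runs (Seq
     (Cond (ILess (Reg ''b'') (Reg ''n''))
       (SetCell ''D'' (IConst 0)
         (RDiv (RMinus (Cell ''F'' (Reg ''b'')) (Cell ''F'' (Reg ''a'')))
           (RMinus (Cell ''X'' (Reg ''b'')) (Cell ''X'' (Reg ''a'')))))
       (SetCell ''D'' (IConst 0) (Cell ''N'' (IConst 0))))
     (Seq (SetCell ''S'' (Reg ''m'') (Cell ''X'' (Reg ''a'')))
     (Seq (SetCell ''W'' (Reg ''m'')
         (RDiv (RMinus (Cell ''D'' (IConst 0)) (Cell ''L'' (IConst 0))) (RConst 2)))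
     (Seq (SetCell ''L'' (IConst 0) (Cell ''D'' (IConst 0)))
     (Seq (SetReg ''m'' (IPlus (Reg ''m'') (IConst 1))) (SetReg ''a'' (Reg ''b''))))))) u 7
     (chain_state (Suc m))"
  proof (rule runs_Seq[where K = 2 and L = 5 and P = "\<lambda>v. v = set_cell ''D'' 0 ?d u"])
    show "runs (Cond (ILess (Reg ''b'') (Reg ''n''))
       (SetCell ''D'' (IConst 0)
         (RDiv (RMinus (Cell ''F'' (Reg ''b'')) (Cell ''F'' (Reg ''a'')))
           (RMinus (Cell ''X'' (Reg ''b'')) (Cell ''X'' (Reg ''a'')))))
       (SetCell ''D'' (IConst 0) (Cell ''N'' (IConst 0)))) u 2 (\<lambda>v. v = set_cell ''D'' 0 ?d u)"
      using u ready_u chain_u pick_m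
      by (intro runs_Cond runs_SetCell) (auto simp: ready_def chain_state_def slope_before_Suc slope_def)
  next
    fix v assume v: "v = set_cell ''D'' 0 ?d u"
    show "runs (Seq (SetCell ''S'' (Reg ''m'') (Cell ''X'' (Reg ''a'')))
     (Seq (SetCell ''W'' (Reg ''m'')
         (RDiv (RMinus (Cell ''D'' (IConst 0)) (Cell ''L'' (IConst 0))) (RConst 2)))
     (Seq (SetCell ''L'' (IConst 0) (Cell ''D'' (IConst 0)))
     (Seq (SetReg ''m'' (IPlus (Reg ''m'') (IConst 1))) (SetReg ''a'' (Reg ''b'')))))) v 5
     (chain_state (Suc m))"
      using u ready_u chain_u pick_m unfolding v
      by (intro runs_Seq_SetCell runs_Seq_SetReg runs_SetReg)
        (auto simp: ready_def chain_state_def pick_Suc set_cell_def set_reg_def less_Suc_eq)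
  qed simp
qed simp

lemma pick_ge: "(\<And>i. i < m \<Longrightarrow> pick i < n) \<Longrightarrow> m \<le> pick m"
proof (induction m)
  case (Suc m)
  then have "m \<le> pick m" "pick m < pick (Suc m)" using less_nxt by (simp_all add: pick_Suc)
  then show ?case by simp
qed simp

lemma pick_le_n: "pick m \<le> n"
  by (cases m) (auto simp: pick_0 pick_Suc nxt_le)

lemma runs_greedy:
  assumes s: "ready s" and init: "chain_state 0 s"
  shows "runs greedy s (((4 * n + 8) * n + 13) * n + 2) (\<lambda>t. \<exists>m. chain_state m t \<and> pick m = n)"
proof -
  have "runs greedy s (((4 * n + 8) * n + 13) * n + 2)
      (\<lambda>t. (\<exists>m. chain_state m t \<and> (m = n \<or> pick m = n)) \<and> frame greedy s t)"
    unfolding greedy_def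
  \<comment> \<open>Either every round so far has produced a point or the chain has ended. After
    \<open>n\<close> rounds the first alternative implies the second by
    \<open>pick_ge\<close>.\<close>
  proof (rule runs_for_loop[where K = "(4 * n + 8) * n + 11" and
      I = "\<lambda>j t. \<exists>m. chain_state m t \<and> (m = j \<or> pick m = n)"], goal_cases)
    case (7 j t)
    then obtain m where m: "chain_state m t" "m = j \<or> pick m = n" by blast
    have t: "ready t"
      by (rule ready_frame[OF s 7(4)]) (auto simp: greedy_step_def search_next_def test_chord_def)
    show ?case
    proof (rule runs_Cond)
      assume "bval (ILess (Reg ''a'') (Reg ''n'')) t"
      then have "pick m < n" using m t by (simp add: chain_state_def ready_def)
      then show "runs greedy_step t ((4 * n + 8) * n + 11 - 1)
          (\<lambda>t. \<exists>m. chain_state m t \<and> (m = Suc j \<or> pick m = n))"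
        using m by (intro runs_mono[OF runs_greedy_step[OF t m(1)]]) auto
    next
      assume "\<not> bval (ILess (Reg ''a'') (Reg ''n'')) t"
      then have "pick m = n" using m t pick_le_n[of m] by (simp add: chain_state_def ready_def)
      then show "runs Skip t ((4 * n + 8) * n + 11 - 1)
          (\<lambda>t. \<exists>m. chain_state m t \<and> (m = Suc j \<or> pick m = n))"
        using m by (intro runs_Skip) auto
    qed simp
  qed (use s init in \<open>auto simp: ready_def chain_state_def set_reg_def greedy_step_def search_next_def
      test_chord_def\<close>)
  then show ?thesis
  proof (rule runs_mono)
    fix t assume "(\<exists>m. chain_state m t \<and> (m = n \<or> pick m = n)) \<and> frame greedy s t"
    then obtain m where m: "chain_state m t" "m = n \<or> pick m = n" by blast
    have "pick m = n"
      using m pick_ge[of m] pick_le_n[of m] by (auto simp: chain_state_def)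
    with m show "\<exists>m. chain_state m t \<and> pick m = n" by blast
  qed simp
qed

end

section \<open>Assembly of correctness, running time and size\<close>

definition time_bound :: "nat poly" where
  "time_bound = ((5 * [:0, 1:] + 10) * [:0, 1:] + 2) + ((5 * [:0, 1:] + 10) * [:0, 1:] + 2) + 1
     + (((4 * [:0, 1:] + 8) * [:0, 1:] + 13) * [:0, 1:] + 2)"

lemma coreset_program_correct:
  assumes P: "distinct xs" "set xs = P" and \<epsilon>: "0 < \<epsilon>" "\<epsilon> < 1"
  shows "\<exists>k t S w. exec coreset_program (input_state xs \<epsilon>) k t \<and> k \<le> poly time_bound (card P)
    \<and> outputs t S w \<and> is_coreset \<epsilon> P S w \<and> real (card S) * sqrt \<epsilon> \<le> 20"
proof -
  define n s where "n = length xs" and "s = input_state xs \<epsilon>"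
  define p where "p = cells s ''P''"
  have p: "i < n \<Longrightarrow> p i = xs ! i" for i by (simp add: p_def s_def input_state_def n_def)
  have inj: "inj_on p {..<n}"
    unfolding inj_on_def using P(1) by (simp add: p nth_eq_iff_index_eq n_def[symmetric])
  have img: "p ` {..<n} = P"
  proof -
    have "p ` {..<n} = (!) xs ` {..<n}" by (intro image_cong) (simp_all add: p)
    also have "\<dots> = P" unfolding P(2)[symmetric] n_def by (auto simp: set_conv_nth)
    finally show ?thesis .
  qed
  have regs_s: "regs s = (\<lambda>x. if x = ''n'' then n else 0)"
    by (rule ext) (simp add: s_def input_state_def n_def)
  obtain k1 s1 where 1: "exec rank_sort s k1 s1" "k1 \<le> (5 * n + 10) * n + 2"
    and s1: "\<And>i. i < n \<Longrightarrow> cells s1 ''X'' (rank p n i) = p i" and fr1: "frame rank_sort s s1"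
    using runs_rank_sort[of s n p, OF _ _ inj] regs_s unfolding runs_def p_def by auto
  define X where "X = cells s1 ''X''"
  have X_less: "i < j \<Longrightarrow> j < n \<Longrightarrow> X i < X j" for i j
    unfolding X_def using sorted_by_rank(1)[OF inj s1] by blast
  have X_img: "X ` {..<n} = P"
    unfolding X_def using sorted_by_rank(2)[OF inj s1] img by blast
  interpret sorted_points X n \<epsilon> by unfold_locales (rule X_less, assumption+, rule \<epsilon>)
  have X_inj: "inj_on X {..<n}"
  proof (rule linorder_inj_onI')
    fix i j assume "j \<in> {..<n}" "i < j"
    then show "X i \<noteq> X j" using X_less[of i j] by simp
  qed
  have cost: "cost P c = f c" for c
    unfolding cost_def f_def X_img[symmetric] sum.reindex[OF X_inj] comp_def ..
  have regs1: "regs s1 ''n'' = n" and N1: "cells s1 ''N'' 0 = 0"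
    using frame_regs[OF fr1, of "''n''"] frame_cells[OF fr1, of "''N''"] regs_s
    by (simp_all add: rank_sort_def s_def input_state_def n_def)
  obtain k2 s2 where 2: "exec tabulate_cost s1 k2 s2" "k2 \<le> (5 * n + 10) * n + 2"
    and tab: "((\<forall>i<n. cells s2 ''F'' i = (\<Sum>j<n. \<bar>X j - X i\<bar>)) \<and> cells s2 ''N'' 0 = real n)
      \<and> frame tabulate_cost s1 s2"
    using runs_tabulate_cost[OF regs1 X_def[symmetric] N1] by (rule runsE)
  have s2: "\<forall>i<n. cells s2 ''F'' i = f (X i)" "cells s2 ''N'' 0 = real n"
    and fr2: "frame tabulate_cost s1 s2"
    using tab unfolding f_def by blast+
  define s3 where "s3 = set_cell ''L'' 0 (- real n) s2"
  have 3: "exec (SetCell ''L'' (IConst 0) (RMinus (RConst 0) (Cell ''N'' (IConst 0)))) s2 1 s3"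
    using exec.SetCell[of "''L''" "IConst 0" "RMinus (RConst 0) (Cell ''N'' (IConst 0))" s2] s2
    by (simp add: s3_def)
  have regs2: "regs s2 x = (if x = ''n'' then n else 0)" if "x \<notin> {''i'', ''j'', ''r''}" for x
    using frame_regs[OF fr1, of x] frame_regs[OF fr2, of x] that regs_s
    by (simp add: rank_sort_def tabulate_cost_def)
  have "cells s2 ''X'' = X" "cells s2 ''eps'' 0 = \<epsilon>"
    using frame_cells[OF fr2, of "''X''"] frame_cells[OF fr1, of "''eps''"] frame_cells[OF fr2, of "''eps''"]
    by (simp_all add: rank_sort_def tabulate_cost_def X_def s_def input_state_def)
  then have "ready s3"
    using s2 regs2[of "''n''"] by (simp add: ready_def s3_def set_cell_def)
  moreover have "chain_state 0 s3"
    using regs2[of "''m''"] regs2[of "''a''"] by (simp add: chain_state_def s3_def set_cell_def pick_0 slope_before_0)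
  ultimately obtain k4 t m where 4: "exec greedy s3 k4 t" "k4 \<le> ((4 * n + 8) * n + 13) * n + 2"
    and m: "chain_state m t" "pick m = n"
    using runs_greedy unfolding runs_def by blast
  interpret greedy_chain X n \<epsilon> m
    by unfold_locales (use m in \<open>auto simp: chain_state_def\<close>)
  have "exec coreset_program s (k1 + (k2 + (1 + k4))) t"
    unfolding coreset_program_def
    by (rule exec.Seq[OF 1(1) exec.Seq[OF 2(1) exec.Seq[OF 3 4(1)]]])
  moreover have "card P = n" using P distinct_card n_def by metis
  then have "k1 + (k2 + (1 + k4)) \<le> poly time_bound (card P)"
    using 1(2) 2(2) 4(2) by (simp add: time_bound_def algebra_simps)
  moreover define S where "S = cells t ''S'' ` {..<m}"
  \<comment> \<open>The machine lists weights by index, whereas a coreset weighs points; injectivity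
    of the listing recovers the index.\<close>
  define w where "w = (\<lambda>x. cells t ''W'' (the_inv_into {..<m} (cells t ''S'') x))"
  have regs_m: "regs t ''m'' = m" and tS: "i < m \<Longrightarrow> cells t ''S'' i = X (pick i)"
    and tW: "i < m \<Longrightarrow> cells t ''W'' i = (slope_before (Suc i) - slope_before i) / 2" for i
    using m by (auto simp: chain_state_def)
  have S_inj: "inj_on (cells t ''S'') {..<m}"
  proof (rule linorder_inj_onI')
    fix i j assume "i \<in> {..<m}" "j \<in> {..<m}" "i < j"
    then show "cells t ''S'' i \<noteq> cells t ''S'' j"
      using X_less[of "pick i" "pick j"] pick_less[of i j] pick_less_n[of j] by (simp add: tS)
  qed
  have w: "w (X (pick i)) = (slope_before (Suc i) - slope_before i) / 2" if "i < m" for i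
    using the_inv_into_f_f[OF S_inj, of i] that by (simp add: w_def tS tW)
  have "outputs t S w"
    unfolding outputs_def regs_m using S_inj by (auto simp: S_def tS w tW)
  moreover have "is_coreset \<epsilon> P S w"
    unfolding is_coreset_def
  proof (intro conjI ballI allI)
    show "S \<subseteq> P" using pick_less_n by (auto simp: S_def tS X_img[symmetric])
    show "0 \<le> w x" if "x \<in> S" for x
      using that slope_before_mono pick_less_n by (auto simp: S_def tS w)
    fix c
    have "(\<Sum>x\<in>S. w x * \<bar>x - c\<bar>) = (\<Sum>i<m. (slope_before (Suc i) - slope_before i) / 2 * \<bar>X (pick i) - c\<bar>)"
      unfolding S_def sum.reindex[OF S_inj] by (intro sum.cong) (auto simp: w tS)
    \<comment> \<open>The interpolant never falls below the cost, so the lower bound only adds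
      \<open>0 \<le> \<epsilon> * f c\<close>.\<close>
    then show "(1 - \<epsilon>) * cost P c \<le> (\<Sum>x\<in>S. w x * \<bar>x - c\<bar>)"
      and "(\<Sum>x\<in>S. w x * \<bar>x - c\<bar>) \<le> (1 + \<epsilon>) * cost P c"
      using weighted_sum_bounds[of c] mult_nonneg_nonneg[OF less_imp_le[OF eps_pos] f_nonneg[of c]]
      by (simp_all add: cost algebra_simps)
  qed
  moreover have "real (card S) * sqrt \<epsilon> \<le> 20"
    using length_bound \<epsilon> by (simp add: S_def card_image[OF S_inj])
  ultimately show ?thesis unfolding s_def by blast
qed

theorem theorem2p1:
  "\<exists>(prog :: com) (C :: real) (T :: nat poly). C > 0 \<and>
     (\<forall>(P :: real set) (xs :: real list) (\<epsilon> :: real).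
        finite P \<and> distinct xs \<and> set xs = P \<and> 0 < \<epsilon> \<and> \<epsilon> < 1 \<longrightarrow>
        (\<exists>k t S w.
           exec prog (input_state xs \<epsilon>) k t \<and> k \<le> poly T (card P) \<and>
           outputs t S w \<and> is_coreset \<epsilon> P S w \<and>
           real (card S) \<le> C * \<epsilon> powr (- 1 / 2) * (1 + ln (1 / \<epsilon>)) powr C))"
proof (rule exI[of _ coreset_program], rule exI[of _ 20], rule exI[of _ time_bound],
    intro conjI allI impI)
  fix P :: "real set" and xs :: "real list" and \<epsilon> :: real
  assume asm: "finite P \<and> distinct xs \<and> set xs = P \<and> 0 < \<epsilon> \<and> \<epsilon> < 1"
  then obtain k t S w where *: "exec coreset_program (input_state xs \<epsilon>) k t"
      "k \<le> poly time_bound (card P)" "outputs t S w" "is_coreset \<epsilon> P S w"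
    and card: "real (card S) * sqrt \<epsilon> \<le> 20"
    using coreset_program_correct by blast
  have "\<epsilon> powr (- 1 / 2) = 1 / sqrt \<epsilon>"
    using asm by (simp add: powr_minus_divide powr_half_sqrt)
  then have "real (card S) \<le> 20 * \<epsilon> powr (- 1 / 2)"
    using card asm by (simp add: pos_le_divide_eq)
  \<comment> \<open>For \<open>\<epsilon> < 1\<close> the logarithm is positive, so the extra factor
    is at least 1.\<close>
  also have "\<dots> \<le> 20 * \<epsilon> powr (- 1 / 2) * (1 + ln (1 / \<epsilon>)) powr 20"
    using asm by (simp add: mult_le_cancel_left1 ge_one_powr_ge_zero)
  finally show "\<exists>k t S w. exec coreset_program (input_state xs \<epsilon>) k t \<and> k \<le> poly time_bound (card P) \<and>
      outputs t S w \<and> is_coreset \<epsilon> P S w \<and>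
      real (card S) \<le> 20 * \<epsilon> powr (- 1 / 2) * (1 + ln (1 / \<epsilon>)) powr 20"
    using * by blast
qed simp

end
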